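(* Consider the DSCMD-N iteration described in the context, and suppose that the network, stochastic-subgradient, noise and mirror-map assumptions listed in the context hold. Let $\alpha_t=\frac1{\sqrt{t+1}}$ and $r_t=\frac1{t+1}$ for all $t\ge0$. Let $$C=\max\{C_1+3C_6,\ 4C_4,\ \sqrt2C_2+2\sqrt2C_3+2\sqrt2C_5\},$$ where $C_1,\dots,C_6$ are the constants defined in the context. Then for every $l\in\mathcal V$ and every integer $T\ge3$, with $\hat x_l^T=\frac1T\sum_{t=1}^Tx_l^t$, $$\mathbb E[F(\hat x_l^T)]-F(x^* )\le\frac{3C}{\sqrt T}.$$
   Context: Problem. $\mathcal V=\{1,\dots,N\}$ is a set of agents; $\mathcal X\subseteq\mathbb R^n$ is nonempty, convex and compact; $f_i,\chi_i:\mathbb R^n\to\mathbb R$ ($i\in\mathcal V$) are convex, possibly nonsmooth; $F_i=f_i+\chi_i$, $F=\sum_{i=1}^N F_i$. The problem is to minimize $F$ over $\mathcal X$; $\mathcal X^*$ is the set of minimizers and $x^*\in\mathcal X^*$. $\|\cdot\|$ is the Euclidean norm. $G_\chi=\max_{i\in\mathcal V}\sup\{\|g\|:g\in\partial\chi_i(x),\,x\in\mathcal X\}$. Mirror map. $\Phi:\mathbb R^n\to\mathbb R$ is continuously differentiable and $\sigma_\Phi$-strongly convex ($\sigma_\Phi>0$): $\Phi(x)\ge\Phi(y)+\langle\nabla\Phi(y),x-y\rangle+\frac{\sigma_\Phi}{2}\|x-y\|^2$. Its Bregman divergence is $D_\Phi(x,y)=\Phi(x)-\Phi(y)-\langle\nabla\Phi(y),x-y\rangle$,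 and $D_{\Phi,\mathcal X}^2=\sup_{x,y\in\mathcal X}D_\Phi(x,y)$ with $D_{\Phi,\mathcal X}\ge 0$. DSCMD-N. Starting from deterministic $x_i^0\in\mathcal X$, with stepsizes $\alpha_t>0$ and noise magnitudes $r_t>0$, for $t=0,1,2,\dots$ and $i\in\mathcal V$: $$y_i^t=\sum_{j=1}^N[P^t]_{ij}(x_j^t+r_t\xi_{ij}^t),\qquad x_i^{t+1}=\arg\min_{x\in\mathcal X}\Big\{\langle\tilde g_i^t,x\rangle+\frac1{\alpha_t}D_\Phi(x,y_i^t)+\chi_i(x)\Big\}.$$ Here $P^t$ is an $N\times N$ weight matrix, $\xi_{ij}^t$ is a random vector in $\mathbb R^n$, and $\tilde g_i^t=\tilde g_i(y_i^t)$ is a stochastic subgradient of $f_i$ queried at $y_i^t$. $\mathcal F_t$ is the $\sigma$-algebra of the history up to time $t$ ($\mathcal F_{-1}$ trivial); all processes are adapted, the noises and stochastic subgradients of time $t$ being $\mathcal F_t$-measurable. Network assumption. Each $P^t$ is doubly stochastic with nonnegative entries; $E^t=\{(i,j):[P^t]_{ij}>0\}$; there is an integer $B\ge1$ such that the graph $(\mathcal V,\bigcup_{t=sB+1}^{(s+1)B}E^t)$ is strongly connected for every $s\ge0$; there is $\theta\in(0,1)$ with $[P^t]_{ii}\ge\theta$ for all $i,t$ and $[P^t]_{ij}\ge\theta$ whenever $(j,i)\in E^t$. Stochastic-subgradient assumption. There is $G_f\ge0$ such that at any $x\in\mathcal X$, $\mathbb E[\tilde g_i(x)\mid\mathcal F_{t-1}]=g_i(x)\in\partial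 f_i(x)$ and $\mathbb E[\|\tilde g_i(x)\|^2\mid\mathcal F_{t-1}]\le G_f^2$; the same holds at the query points: conditionally on $\mathcal F_{t-1}$ and the time-$t$ noises, $\tilde g_i^t$ has mean $g_i(y_i^t)\in\partial f_i(y_i^t)$ and second moment (of the norm) at most $G_f^2$. Noise assumption. At each time $t$, the noise on link $(i,j)$ is independent of the noise on link $(i',j')$ for $i\ne i'$, $j\neq j'$; and $\mathbb E[\|\xi_{ij}^t\|^2\mid\mathcal F_{t-1}]\le\nu$ for all $i,j\in\mathcal V$ and $t$. Mirror-map assumption. $\|\nabla\Phi(x)-\nabla\Phi(y)\|\le L_\Phi\|x-y\|$ for all $x,y\in\mathbb R^n$; and $D_\Phi(a,\sum_{i=1}^N\nu_ib_i)\le\sum_{i=1}^N\nu_iD_\Phi(a,b_i)$ for all $a,b_1,\dots,b_N\in\mathbb R^n$ and $\nu_i\in[0,1]$ with $\sum_i\nu_i=1$. Constants. With $\omega=(1-\frac{\theta}{4N^2})^{-2}$ and $\gamma=(1-\frac{\theta}{4N^2})^{1/B}$: $C_1=\frac{2N\omega}{1-\gamma}[(N+1)G_f+NG_\chi]\sum_{j=1}^N\|x_j^0\|$; $C_2=ND_{\Phi,\mathcal X}^2$; $C_3=\big((4N+\frac{2N^2\omega}{1-\gamma})[(N+1)G_f+NG_\chi]+NG_\chi\big)\frac{G_f+G_\chi}{\sigma_\Phi}+\frac{NG_f^2}{2\sigma_\Phi}$; $C_4=(4N+\frac{2N^2\omega}{1-\gamma})[(N+1)G_f+NG_\chi]N\sqrt\nu+(G_f+G_\chi)N^2\sqrt\nu$;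 $C_5=\sqrt{2/\sigma_\Phi}\,D_{\Phi,\mathcal X}L_\Phi N\sqrt\nu$; $C_6=NL_\Phi\nu$. *)

theory Defs
  imports
    "HOL-Probability.Probability"
    "HOL-Probability.Stopping_Time"
    "Graph_Theory.Digraph_Component"
begin

definition subdifferential :: "('a::real_inner \<Rightarrow> real) \<Rightarrow> 'a \<Rightarrow> 'a set" where
  "subdifferential f x = {g. \<forall>y. f y \<ge> f x + inner g (y - x)}"

(* For convex, everywhere finite chi and nonempty compact X the set of subgradient norms
   is nonempty and bounded, so the supremum below is a genuine one. *)
definition max_subgradient_norm ::
  "'a::real_inner set \<Rightarrow> ('v::finite \<Rightarrow> 'a \<Rightarrow> real) \<Rightarrow> real" where
  "max_subgradient_norm X chi = (MAX i. Sup {norm g | g x. x \<in> X \<and> g \<in> subdifferential (chi i) x})"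

definition mirror_map :: "('a::real_inner \<Rightarrow> real) \<Rightarrow> ('a \<Rightarrow> 'a) \<Rightarrow> real \<Rightarrow> bool" where
  "mirror_map Phi dPhi sigmaPhi \<longleftrightarrow>
     (\<forall>x. GDERIV Phi x :> dPhi x) \<and> continuous_on UNIV dPhi \<and> sigmaPhi > 0 \<and>
     (\<forall>x y. Phi x \<ge> Phi y + inner (dPhi y) (x - y) + sigmaPhi / 2 * (norm (x - y))\<^sup>2)"

definition bregman :: "('a::real_inner \<Rightarrow> real) \<Rightarrow> ('a \<Rightarrow> 'a) \<Rightarrow> 'a \<Rightarrow> 'a \<Rightarrow> real" where
  "bregman Phi dPhi x y = Phi x - Phi y - inner (dPhi y) (x - y)"

(* The nonnegative number whose square is the supremum of the divergence over X. *)
definition bregman_diameter ::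
  "('a::real_inner \<Rightarrow> real) \<Rightarrow> ('a \<Rightarrow> 'a) \<Rightarrow> 'a set \<Rightarrow> real" where
  "bregman_diameter Phi dPhi X = sqrt (Sup {bregman Phi dPhi x y | x y. x \<in> X \<and> y \<in> X})"

definition doubly_stochastic :: "real^'v^'v::finite \<Rightarrow> bool" where
  "doubly_stochastic A \<longleftrightarrow>
     (\<forall>i j. A $ i $ j \<ge> 0) \<and> (\<forall>i. (\<Sum>j\<in>UNIV. A $ i $ j) = 1) \<and> (\<forall>j. (\<Sum>i\<in>UNIV. A $ i $ j) = 1)"

definition weight_edges :: "real^'v^'v::finite \<Rightarrow> ('v \<times> 'v) set" where
  "weight_edges A = {(i, j). A $ i $ j > 0}"

(* The lower bound on A_ij is required for (j,i) in the edge set, i.e. when A_ji > 0;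
   the index order is intentional. *)
definition network_assumption ::
  "(nat \<Rightarrow> real^'v^'v::finite) \<Rightarrow> nat \<Rightarrow> real \<Rightarrow> bool" where
  "network_assumption P B theta \<longleftrightarrow>
     (\<forall>t. doubly_stochastic (P t)) \<and>
     B \<ge> 1 \<and>
     (\<forall>s. strongly_connected
            \<lparr>verts = UNIV, arcs = (\<Union>t\<in>{s * B + 1..(s + 1) * B}. weight_edges (P t)),
             tail = fst, head = snd\<rparr>) \<and>
     0 < theta \<and> theta < 1 \<and>
     (\<forall>t i. P t $ i $ i \<ge> theta) \<and>
     (\<forall>t i j. (j, i) \<in> weight_edges (P t) \<longrightarrow> P t $ i $ j \<ge> theta)"

(* Componentwise, since the library only has real-valued conditional expectations. *)
definition vec_cond_exp ::
  "'w measure \<Rightarrow> 'w measure \<Rightarrow> ('w \<Rightarrow> real^'n::finite) \<Rightarrow> 'w \<Rightarrow> real^'n" where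
  "vec_cond_exp M S Z w = (\<chi> k. real_cond_exp M S (\<lambda>w. Z w $ k) w)"

(* The sigma-algebra generated by S together with the noises of one time step. *)
definition join_noise ::
  "'w measure \<Rightarrow> 'w measure \<Rightarrow> ('v \<Rightarrow> 'v \<Rightarrow> 'w \<Rightarrow> real^'n::finite) \<Rightarrow> 'w measure" where
  "join_noise M S xi =
     sigma (space M) (sets S \<union> {xi i j -` A \<inter> space M | i j A. A \<in> sets borel})"

(* Given the sub-sigma-algebra S, the random vector Z has conditional mean m and its squared
   norm has conditional mean at most c. The second moment is taken in ennreal, so the bound
   makes Z square integrable and vec_cond_exp M S Z a genuine conditional expectation. *)
definition cond_moments ::
  "'w measure \<Rightarrow> 'w measure \<Rightarrow> ('w \<Rightarrow> real^'n::finite) \<Rightarrow> ('w \<Rightarrow> real^'n) \<Rightarrow> real \<Rightarrow> bool" where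
  "cond_moments M S Z m c \<longleftrightarrow>
     (AE w in M. vec_cond_exp M S Z w = m w) \<and>
     (AE w in M. nn_cond_exp M S (\<lambda>w. ennreal ((norm (Z w))\<^sup>2)) w \<le> ennreal c)"

(* Fil t is the sigma-algebra at time t. Integer times make Fil (- 1) available; all earlier
   ones are then trivial too. G t i z is the stochastic subgradient of f i returned at time t
   when queried at z. The iterate x (Suc t) is computed from the data of time t. *)
definition history ::
  "'w measure \<Rightarrow> (int \<Rightarrow> 'w measure) \<Rightarrow> (real^'n::finite) set
   \<Rightarrow> (nat \<Rightarrow> 'v \<Rightarrow> 'v \<Rightarrow> 'w \<Rightarrow> real^'n) \<Rightarrow> (nat \<Rightarrow> 'v \<Rightarrow> real^'n \<Rightarrow> 'w \<Rightarrow> real^'n)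
   \<Rightarrow> (nat \<Rightarrow> 'v \<Rightarrow> 'w \<Rightarrow> real^'n) \<Rightarrow> (nat \<Rightarrow> 'v \<Rightarrow> 'w \<Rightarrow> real^'n) \<Rightarrow> bool" where
  "history M Fil X xi G x y \<longleftrightarrow>
     filtration (space M) Fil \<and> (\<forall>t. subalgebra M (Fil t)) \<and>
     sets (Fil (- 1)) = {{}, space M} \<and>
     (\<forall>t i j. xi t i j \<in> borel_measurable (Fil (int t))) \<and>
     (\<forall>t i. \<forall>z\<in>X. G t i z \<in> borel_measurable (Fil (int t))) \<and>
     (\<forall>t i. (\<lambda>w. G t i (y t i w) w) \<in> borel_measurable (Fil (int t))) \<and>
     (\<forall>t i. y t i \<in> borel_measurable (Fil (int t))) \<and>
     (\<forall>t i. x (Suc t) i \<in> borel_measurable (Fil (int t)))"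

definition subgradient_assumption ::
  "'w measure \<Rightarrow> (int \<Rightarrow> 'w measure) \<Rightarrow> (real^'n::finite) set
   \<Rightarrow> ('v \<Rightarrow> real^'n \<Rightarrow> real) \<Rightarrow> ('v \<Rightarrow> real^'n \<Rightarrow> real^'n) \<Rightarrow> real
   \<Rightarrow> (nat \<Rightarrow> 'v \<Rightarrow> 'v \<Rightarrow> 'w \<Rightarrow> real^'n) \<Rightarrow> (nat \<Rightarrow> 'v \<Rightarrow> real^'n \<Rightarrow> 'w \<Rightarrow> real^'n)
   \<Rightarrow> (nat \<Rightarrow> 'v \<Rightarrow> 'w \<Rightarrow> real^'n) \<Rightarrow> bool" where
  "subgradient_assumption M Fil X f g Gf xi G y \<longleftrightarrow>
     Gf \<ge> 0 \<and>
     (\<forall>t i. \<forall>z\<in>X.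
        g i z \<in> subdifferential (f i) z \<and>
        cond_moments M (Fil (int t - 1)) (G t i z) (\<lambda>w. g i z) (Gf\<^sup>2)) \<and>
     (\<forall>t i.
        (AE w in M. g i (y t i w) \<in> subdifferential (f i) (y t i w)) \<and>
        cond_moments M (join_noise M (Fil (int t - 1)) (xi t))
          (\<lambda>w. G t i (y t i w) w) (\<lambda>w. g i (y t i w)) (Gf\<^sup>2))"

definition noise_assumption ::
  "'w measure \<Rightarrow> (int \<Rightarrow> 'w measure) \<Rightarrow> (nat \<Rightarrow> 'v \<Rightarrow> 'v \<Rightarrow> 'w \<Rightarrow> real^'n::finite)
   \<Rightarrow> real \<Rightarrow> bool" where
  "noise_assumption M Fil xi nu \<longleftrightarrow>
     nu \<ge> 0 \<and>
     (\<forall>t i j i' j'. i \<noteq> i' \<and> j \<noteq> j' \<longrightarrow>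
        prob_space.indep_var M borel (xi t i j) borel (xi t i' j')) \<and>
     (\<forall>t i j. AE w in M.
        nn_cond_exp M (Fil (int t - 1)) (\<lambda>w. ennreal ((norm (xi t i j w))\<^sup>2)) w \<le> ennreal nu)"

definition dscmd_n ::
  "'w measure \<Rightarrow> (real^'n::finite) set \<Rightarrow> ('v::finite \<Rightarrow> real^'n \<Rightarrow> real)
   \<Rightarrow> (real^'n \<Rightarrow> real) \<Rightarrow> (real^'n \<Rightarrow> real^'n) \<Rightarrow> (nat \<Rightarrow> real^'v^'v)
   \<Rightarrow> (nat \<Rightarrow> real) \<Rightarrow> (nat \<Rightarrow> real)
   \<Rightarrow> (nat \<Rightarrow> 'v \<Rightarrow> 'v \<Rightarrow> 'w \<Rightarrow> real^'n) \<Rightarrow> (nat \<Rightarrow> 'v \<Rightarrow> real^'n \<Rightarrow> 'w \<Rightarrow> real^'n)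
   \<Rightarrow> ('v \<Rightarrow> real^'n)
   \<Rightarrow> (nat \<Rightarrow> 'v \<Rightarrow> 'w \<Rightarrow> real^'n) \<Rightarrow> (nat \<Rightarrow> 'v \<Rightarrow> 'w \<Rightarrow> real^'n) \<Rightarrow> bool" where
  "dscmd_n M X chi Phi dPhi P alpha r xi G x0 x y \<longleftrightarrow>
     (\<forall>i. x0 i \<in> X) \<and>
     (\<forall>i. \<forall>w\<in>space M. x 0 i w = x0 i) \<and>
     (\<forall>t i. \<forall>w\<in>space M.
        y t i w = (\<Sum>j\<in>UNIV. P t $ i $ j *\<^sub>R (x t j w + r t *\<^sub>R xi t i j w))) \<and>
     (\<forall>t i. \<forall>w\<in>space M.
        is_arg_min
          (\<lambda>z. inner (G t i (y t i w) w) z + 1 / alpha t * bregman Phi dPhi z (y t i w) + chi i z)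
          (\<lambda>z. z \<in> X) (x (Suc t) i w))"

end

(* Comparing the prox step with x* and telescoping the Bregman divergences bounds the regret by
   the usual sqrt T terms plus (Gf + Gchi) times the accumulated disagreement of the agents.
   The disagreement is the delicate part: the query point y lies outside X, so the step
   x(t+1) - y cannot be compared with y itself. The step is measured from the noiseless average
   w = sum_j P_ij x_j in X instead, which gives
   |x(t+1) - w| <= 2 alpha (|g| + Gchi) / sigma + sqrt (2 L / sigma) r |noise|;
   the second term carries a condition number that does not occur in C4. It is absorbed as follows.
   With R = 4 N^4 B / theta, the disagreement is bounded by the diameter d of X up to time
   sqrt (R T), and the consensus recursion is restarted there. In the remaining phase the sum
   of r is at most sqrt (T / R), and AM-GM distributes the cross terms over C2, C3 and C6. *)
theory Submission
  imports Defs
begin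

section \<open>Averaging with doubly stochastic matrices\<close>

text \<open>The threshold \<open>sqrt (R T)\<close> balances two costs. A restart at time
  \<open>s\<close> costs about \<open>s * d\<close> for the phase before it and leaves a noise cost
  of about \<open>R * sqrt (2 * L * nu / sigma) * T / s\<close>; at the threshold both are of order
  \<open>sqrt (R T)\<close>. AM-GM against \<open>Gf + H\<close> turns them into
  \<open>sqrt T\<close> times \<open>sigma * d\<^sup>2\<close>,
  \<open>R * (Gf + H)\<^sup>2 / sigma\<close> and \<open>L * nu\<close>, the shapes of C2, C3 and
  C6. R comes from the network: the squared dispersion shrinks at least by
  \<open>1 - 4 * theta / N ^ 3\<close> per window, so a dispersion summed over all time is about
  \<open>B * N ^ 3 / (2 * theta)\<close> times its initial size, and a factor \<open>2 * N\<close>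
  for the sum over agents gives \<open>R / 4\<close>. The constants omega and gamma enter through
  \<open>R \<le> N\<^sup>2 * omega / (1 - gamma)\<close>. The absorption lives on slack:
  \<open>3 * C\<close> bounds the sum of the three members of the maximum,
  \<open>sqrt 2 \<ge> 7 / 5\<close> leaves two fifths of C2 beyond the telescoped term, and
  \<open>T \<ge> 3\<close> makes the bounded noise term small against \<open>sqrt T\<close>.\<close>

lemma exists_large_gap:
  fixes A :: "real set"
  assumes "finite A" "card A = Suc n" "p \<in> A" "q \<in> A" "q - p > real n * h"
  shows "\<exists>u\<in>A. \<exists>v\<in>A. v - u > h \<and> (\<forall>z\<in>A. z \<le> u \<or> v \<le> z)"
  using assms
proof (induction n arbitrary: A p q)
  case 0
  then obtain z where "A = {z}" using card_1_singletonE by (metis One_nat_def)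
  then show ?case using 0 by auto
next
  case (Suc n)
  define M where "M = Max A"
  define A' where "A' = A - {M}"
  have M: "M \<in> A" "\<And>z. z \<in> A \<Longrightarrow> z \<le> M"
    using Suc.prems unfolding M_def by (auto intro!: Max_in)
  have A': "finite A'" "card A' = Suc n" using Suc.prems M by (auto simp: A'_def)
  define M' where "M' = Max A'"
  have ne: "A' \<noteq> {}" using A' by auto
  have M': "M' \<in> A'" "\<And>z. z \<in> A' \<Longrightarrow> z \<le> M'" using A' ne by (auto simp: M'_def)
  show ?case
  proof (cases "M - M' > h")
    case True
    then show ?thesis using M M' unfolding A'_def by blast
  next
    case False
    show ?thesis
    proof (cases "p = M")
      case True
      then have "q \<le> p" using M Suc.prems by auto
      then have "h < 0" using Suc.prems(5)
        by (smt (verit, best) mult_nonneg_nonneg of_nat_0_le_iff)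
      then show ?thesis using False M M' unfolding A'_def by (smt (verit) DiffE)
    next
      \<comment> \<open>Removing the maximum costs at most \<open>h\<close> of the span, so
        \<open>p\<close> and \<open>M'\<close> still violate the bound in a set with one point
        fewer.\<close>
      case False': False
      have "q \<le> M" using M Suc.prems by auto
      then have "M' - p > real n * h" using Suc.prems(5) False by (simp add: algebra_simps)
      moreover have "p \<in> A'" using Suc.prems False' by (auto simp: A'_def)
      ultimately obtain u v where "u \<in> A'" "v \<in> A'" "v - u > h" "\<forall>z\<in>A'. z \<le> u \<or> v \<le> z"
        using Suc.IH[OF A' _ M'(1)] by blast
      then show ?thesis using M M' unfolding A'_def by (metis DiffD1 DiffI singletonD)
    qed
  qed
qed

section \<open>Dispersion around the mean and its loss in one averaging step\<close>

definition mix :: "real^'v^'v::finite \<Rightarrow> ('v \<Rightarrow> 'a::real_vector) \<Rightarrow> 'v \<Rightarrow> 'a" where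
  "mix A z i = (\<Sum>j\<in>UNIV. A $ i $ j *\<^sub>R z j)"

definition mean :: "('v::finite \<Rightarrow> 'a::real_vector) \<Rightarrow> 'a" where
  "mean z = (1 / real CARD('v)) *\<^sub>R (\<Sum>i\<in>UNIV. z i)"

text \<open>The Euclidean distance of the family from the consensus families, i.e. the square root
  of \<open>CARD('v)\<close> times the variance. In this norm the loss under averaging is an
  identity, and its square splits over coordinates.\<close>

definition disp :: "('v::finite \<Rightarrow> 'a::real_normed_vector) \<Rightarrow> real" where
  "disp z = L2_set (\<lambda>i. norm (z i - mean z)) UNIV"

lemma mean_add: "mean (\<lambda>i. a i + b i) = mean a + mean b"
  by (simp add: mean_def sum.distrib scaleR_add_right)

lemma mix_add: "mix A (\<lambda>i. a i + b i) = (\<lambda>i. mix A a i + mix A b i)"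
  by (simp add: mix_def sum.distrib scaleR_add_right fun_eq_iff)

lemma disp_nonneg: "disp z \<ge> 0"
  by (simp add: disp_def)

lemma disp_add: "disp (\<lambda>i. a i + b i) \<le> disp a + disp b"
proof -
  have "disp (\<lambda>i. a i + b i) \<le> L2_set (\<lambda>i. norm (a i - mean a) + norm (b i - mean b)) UNIV"
    unfolding disp_def mean_add
    by (intro L2_set_mono) (auto simp: add_diff_add intro: norm_triangle_ineq)
  also have "\<dots> \<le> disp a + disp b" unfolding disp_def by (rule L2_set_triangle_ineq)
  finally show ?thesis .
qed

lemma disp_sq: "(disp z)\<^sup>2 = (\<Sum>i\<in>UNIV. (norm (z i - mean z))\<^sup>2)"
  by (simp add: disp_def L2_set_def sum_nonneg)

text \<open>Parallel axis identity: the cross term vanishes because deviations from the mean sum to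
  zero. Hence \<open>disp\<close> may be estimated from any convenient centre
  \<open>c\<close>.\<close>

lemma sum_sq_shift:
  fixes z :: "'v::finite \<Rightarrow> 'a::real_inner"
  shows "(\<Sum>i\<in>UNIV. (norm (z i - c))\<^sup>2) = (disp z)\<^sup>2 + real CARD('v) * (norm (mean z - c))\<^sup>2"
proof -
  have s: "(\<Sum>i\<in>UNIV. z i - mean z) = 0"
    by (simp add: sum_subtractf mean_def sum_constant_scaleR)
  have "(norm (z i - c))\<^sup>2 = (norm (z i - mean z))\<^sup>2 + 2 * inner (z i - mean z) (mean z - c)
      + (norm (mean z - c))\<^sup>2" for i
    by (simp add: power2_norm_eq_inner inner_diff_left inner_diff_right inner_commute algebra_simps)
  then have "(\<Sum>i\<in>UNIV. (norm (z i - c))\<^sup>2) = (disp z)\<^sup>2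
      + 2 * (\<Sum>i\<in>UNIV. inner (z i - mean z) (mean z - c)) + real CARD('v) * (norm (mean z - c))\<^sup>2"
    by (simp add: sum.distrib disp_sq sum_distrib_left)
  then show ?thesis by (simp add: inner_sum_left[symmetric] s)
qed

lemma disp_sq_le:
  fixes z :: "'v::finite \<Rightarrow> 'a::real_inner"
  shows "(disp z)\<^sup>2 \<le> (\<Sum>i\<in>UNIV. (norm (z i - c))\<^sup>2)"
  using sum_sq_shift[of z c] by simp

lemma disp_le_sum:
  fixes z :: "'v::finite \<Rightarrow> 'a::real_inner"
  shows "disp z \<le> (\<Sum>i\<in>UNIV. norm (z i - c))"
proof -
  have "disp z \<le> L2_set (\<lambda>i. norm (z i - c)) UNIV"
    using disp_sq_le[of z c] unfolding L2_set_def by (intro real_le_rsqrt) 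
  also have "\<dots> \<le> (\<Sum>i\<in>UNIV. norm (z i - c))" by (rule L2_set_le_sum) auto
  finally show ?thesis .
qed

lemma norm_diff_le_disp:
  fixes z :: "'v::finite \<Rightarrow> 'a::real_inner"
  shows "norm (z l - z i) \<le> 2 * disp z"
proof -
  have "norm (z k - mean z) \<le> disp z" for k
    unfolding disp_def by (rule member_le_L2_set) auto
  from this[of l] this[of i] show ?thesis
    using norm_triangle_ineq4[of "z l - mean z" "z i - mean z"] by simp
qed

lemma mean_mix:
  assumes "doubly_stochastic A"
  shows "mean (mix A z) = mean z"
proof -
  have "(\<Sum>i\<in>UNIV. mix A z i) = (\<Sum>j\<in>UNIV. \<Sum>i\<in>UNIV. A $ i $ j *\<^sub>R z j)"
    unfolding mix_def by (rule sum.swap)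
  also have "\<dots> = (\<Sum>j\<in>UNIV. z j)"
    using assms by (simp add: scaleR_sum_left[symmetric] doubly_stochastic_def)
  finally show ?thesis by (simp add: mean_def)
qed

text \<open>Unit column sums spread each squared deviation over the rows. Unit row sums make every
  row a probability weight, for which the second moment about \<open>c\<close> is squared bias plus
  variance. Averaging thus loses precisely the variances within the rows.\<close>

lemma disp_mix:
  fixes z :: "'v::finite \<Rightarrow> 'a::real_inner"
  assumes "doubly_stochastic A"
  shows "(disp z)\<^sup>2 = (disp (mix A z))\<^sup>2
    + (\<Sum>k\<in>UNIV. \<Sum>j\<in>UNIV. A $ k $ j * (norm (z j - mix A z k))\<^sup>2)"
proof -
  define c where "c = mean z"
  have row: "(\<Sum>j\<in>UNIV. A $ k $ j) = 1" for k using assms by (simp add: doubly_stochastic_def)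
  have s: "(\<Sum>j\<in>UNIV. A $ k $ j *\<^sub>R (z j - mix A z k)) = 0" for k
    by (simp add: scaleR_diff_right sum_subtractf scaleR_sum_left[symmetric] row mix_def[symmetric])
  have "(disp z)\<^sup>2 = (\<Sum>j\<in>UNIV. \<Sum>k\<in>UNIV. A $ k $ j * (norm (z j - c))\<^sup>2)"
    using assms by (simp add: disp_sq c_def sum_distrib_right[symmetric] doubly_stochastic_def)
  also have "\<dots> = (\<Sum>k\<in>UNIV. \<Sum>j\<in>UNIV. A $ k $ j * (norm (z j - c))\<^sup>2)" by (rule sum.swap)
  also have "\<dots> = (\<Sum>k\<in>UNIV. (norm (mix A z k - c))\<^sup>2
      + (\<Sum>j\<in>UNIV. A $ k $ j * (norm (z j - mix A z k))\<^sup>2))"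
  proof (rule sum.cong[OF refl])
    fix k
    have "A $ k $ j * (norm (z j - c))\<^sup>2 = A $ k $ j * (norm (z j - mix A z k))\<^sup>2
        + 2 * inner (A $ k $ j *\<^sub>R (z j - mix A z k)) (mix A z k - c)
        + A $ k $ j * (norm (mix A z k - c))\<^sup>2" for j
      by (simp add: power2_norm_eq_inner inner_diff_left inner_diff_right inner_commute algebra_simps)
    then have "(\<Sum>j\<in>UNIV. A $ k $ j * (norm (z j - c))\<^sup>2)
       = (\<Sum>j\<in>UNIV. A $ k $ j * (norm (z j - mix A z k))\<^sup>2)
        + 2 * inner (\<Sum>j\<in>UNIV. A $ k $ j *\<^sub>R (z j - mix A z k)) (mix A z k - c)
        + (\<Sum>j\<in>UNIV. A $ k $ j) * (norm (mix A z k - c))\<^sup>2"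
      by (simp only: sum.distrib sum_distrib_left sum_distrib_right inner_sum_left)
    then show "(\<Sum>j\<in>UNIV. A $ k $ j * (norm (z j - c))\<^sup>2) = (norm (mix A z k - c))\<^sup>2
      + (\<Sum>j\<in>UNIV. A $ k $ j * (norm (z j - mix A z k))\<^sup>2)" by (simp add: s row)
  qed
  also have "\<dots> = (disp (mix A z))\<^sup>2
    + (\<Sum>k\<in>UNIV. \<Sum>j\<in>UNIV. A $ k $ j * (norm (z j - mix A z k))\<^sup>2)"
    by (simp add: sum.distrib disp_sq mean_mix[OF assms] c_def)
  finally show ?thesis .
qed

lemma disp_mix_le:
  fixes z :: "'v::finite \<Rightarrow> 'a::real_inner"
  assumes "doubly_stochastic A"
  shows "disp (mix A z) \<le> disp z"
proof -
  have "(disp (mix A z))\<^sup>2 \<le> (disp z)\<^sup>2"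
    using disp_mix[OF assms, of z] assms by (auto simp: doubly_stochastic_def intro!: sum_nonneg)
  then show ?thesis using disp_nonneg power2_le_imp_le by blast
qed

text \<open>The contraction argument orders real values and looks for a gap, so vectors have to be
  treated coordinate by coordinate.\<close>

lemma disp_sq_components:
  fixes z :: "'v::finite \<Rightarrow> 'a::euclidean_space"
  shows "(disp z)\<^sup>2 = (\<Sum>b\<in>Basis. (disp (\<lambda>i. inner (z i) b))\<^sup>2)"
proof -
  have "inner (mean z) b = mean (\<lambda>i. inner (z i) b)" for b
    by (simp add: mean_def inner_sum_left)
  moreover have "(norm v)\<^sup>2 = (\<Sum>b\<in>Basis. (inner v b)\<^sup>2)" for v :: 'a
    by (simp add: norm_eq_sqrt_inner euclidean_inner[of v v] sum_nonneg power2_eq_square)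
  ultimately show ?thesis
    unfolding disp_sq by (subst sum.swap) (simp add: inner_diff_left)
qed

lemma mix_ge:
  assumes "doubly_stochastic A" "\<And>j. A $ i $ j > 0 \<Longrightarrow> z j \<ge> (c::real)"
  shows "mix A z i \<ge> c"
proof -
  have "c = (\<Sum>j\<in>UNIV. A $ i $ j * c)"
    using assms(1) by (simp add: sum_distrib_right[symmetric] doubly_stochastic_def)
  also have "\<dots> \<le> mix A z i" unfolding mix_def real_scaleR_def
  proof (rule sum_mono)
    fix j show "A $ i $ j * c \<le> A $ i $ j * z j"
    proof (cases "A $ i $ j > 0")
      case False
      then have "A $ i $ j = 0" using assms(1) by (auto simp: doubly_stochastic_def intro: order.antisym)
      then show ?thesis by simp
    qed (use assms in auto)
  qed
  finally show ?thesis .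
qed

lemma mix_uminus: "mix A (\<lambda>i. - z i) i = - mix A z i"
  by (simp add: mix_def sum_negf)

lemma mix_le:
  assumes "doubly_stochastic A" "\<And>j. A $ i $ j > 0 \<Longrightarrow> z j \<le> (c::real)"
  shows "mix A z i \<le> c"
  using mix_ge[OF assms(1), of i "- c" "\<lambda>i. - z i"] assms(2) by (simp add: mix_uminus)

text \<open>Rows \<open>a\<close> and \<open>b\<close> both put weight at least \<open>theta\<close>
  on both values. Whatever the row average, the variance within each of these rows is then at least
  \<open>theta * (z a - z b)\<^sup>2 / 2\<close>.\<close>

lemma disp_mix_edge:
  fixes z :: "'v::finite \<Rightarrow> real"
  assumes A: "doubly_stochastic A" and ab: "a \<noteq> b"
    and pos: "A $ a $ a \<ge> theta" "A $ a $ b \<ge> theta" "A $ b $ a \<ge> theta" "A $ b $ b \<ge> theta"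
    and th: "theta \<ge> 0"
  shows "(disp (mix A z))\<^sup>2 \<le> (disp z)\<^sup>2 - theta * (z a - z b)\<^sup>2"
proof -
  have nn: "A $ k $ j \<ge> 0" for k j using A by (simp add: doubly_stochastic_def)
  define Q where "Q k = (\<Sum>j\<in>UNIV. A $ k $ j * (norm (z j - mix A z k))\<^sup>2)" for k
  have Q0: "Q k \<ge> 0" for k unfolding Q_def by (intro sum_nonneg mult_nonneg_nonneg nn) auto
  have Q: "Q k \<ge> theta * (z a - z b)\<^sup>2 / 2" if "A $ k $ a \<ge> theta" "A $ k $ b \<ge> theta" for k
  proof -
    define m where "m = mix A z k"
    have "(z a - z b)\<^sup>2 / 2 \<le> (z a - m)\<^sup>2 + (z b - m)\<^sup>2"
      using zero_le_power2[of "z a + z b - 2 * m"] by (simp add: power2_eq_square field_simps)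
    then have "theta * ((z a - z b)\<^sup>2 / 2) \<le> theta * ((z a - m)\<^sup>2 + (z b - m)\<^sup>2)"
      by (intro mult_left_mono th)
    also have "\<dots> \<le> A $ k $ a * (z a - m)\<^sup>2 + A $ k $ b * (z b - m)\<^sup>2"
      unfolding distrib_left by (intro add_mono mult_right_mono that) auto
    also have "\<dots> = (\<Sum>j\<in>{a,b}. A $ k $ j * (norm (z j - m))\<^sup>2)" using ab by simp
    also have "\<dots> \<le> Q k" unfolding Q_def m_def by (intro sum_mono2) (auto intro!: nn mult_nonneg_nonneg)
    finally show ?thesis by simp
  qed
  have "theta * (z a - z b)\<^sup>2 \<le> (\<Sum>k\<in>{a,b}. Q k)" using ab Q[of a] Q[of b] pos by simp
  also have "\<dots> \<le> (\<Sum>k\<in>UNIV. Q k)" by (intro sum_mono2) (auto intro: Q0)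
  finally show ?thesis using disp_mix[OF A, of z] unfolding Q_def by simp
qed

section \<open>Contraction of weight-matrix products over connectivity windows\<close>

fun flow :: "(nat \<Rightarrow> real^'v^'v::finite) \<Rightarrow> nat \<Rightarrow> nat \<Rightarrow> ('v \<Rightarrow> 'a::real_vector) \<Rightarrow> 'v \<Rightarrow> 'a" where
  "flow P s 0 z = z"
| "flow P s (Suc n) z = mix (P (s + n)) (flow P s n z)"

lemma flow_flow: "flow P s (m + n) z = flow P (s + m) n (flow P s m z)"
  by (induction n) (auto simp: add.assoc)

lemma inner_mix: "(\<lambda>i. inner (mix A z i) b) = mix A (\<lambda>i. inner (z i) b)"
  by (simp add: mix_def inner_sum_left fun_eq_iff)

lemma inner_flow: "(\<lambda>i. inner (flow P s n z i) b) = flow P s n (\<lambda>i. inner (z i) b)"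
  by (induction n) (auto simp: inner_mix)

lemma disp_flow_le:
  fixes z :: "'v::finite \<Rightarrow> 'a::real_inner"
  assumes "\<And>t. doubly_stochastic (P t)"
  shows "disp (flow P s n z) \<le> disp z"
  by (induction n) (auto intro: order_trans[OF disp_mix_le[OF assms]])

lemma disp_flow_antimono:
  fixes z :: "'v::finite \<Rightarrow> 'a::real_inner"
  assumes "\<And>t. doubly_stochastic (P t)" "m \<le> n"
  shows "disp (flow P s n z) \<le> disp (flow P s m z)"
  using disp_flow_le[OF assms(1), where s = "s + m" and n = "n - m" and z = "flow P s m z"] flow_flow[of P s m "n - m" z] assms(2)
  by simp

lemma reachable_cut:
  assumes "strongly_connected \<lparr>verts = UNIV, arcs = E, tail = fst, head = snd\<rparr>"
    and "p \<in> S" "q \<notin> S"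
  shows "\<exists>a b. a \<in> S \<and> b \<notin> S \<and> (a, b) \<in> E"
proof (rule ccontr)
  let ?G = "\<lparr>verts = UNIV, arcs = E, tail = fst, head = snd\<rparr>"
  assume no: "\<not> ?thesis"
  have "p \<rightarrow>\<^sup>*\<^bsub>?G\<^esub> q" using assms(1) by (auto simp: strongly_connected_def)
  then have "(p, q) \<in> rtrancl_on UNIV (arcs_ends ?G)" by (simp add: reachable_def)
  then have "q \<in> S"
  proof (induction rule: rtrancl_on_induct)
    case base show ?case by (fact assms)
  next
    case (step y z)
    then have "(y, z) \<in> E" by (auto simp: arcs_ends_def arc_to_ends_def)
    with step no show ?case by blast
  qed
  with assms show False by simp
qed

text \<open>Within a window the values above and below the widest gap of the initial values stay apart
  until the first edge crosses the gap. The support of the weights is symmetric, so at that time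
  two rows average across the gap, and each lowers the variance by half of theta times its square.\<close>
lemma disp_flow_window_real:
  fixes z :: "'v::finite \<Rightarrow> real"
  assumes net: "network_assumption P B theta"
  shows "(disp (flow P (k * B + 1) B z))\<^sup>2 \<le> (1 - 4 * theta / real CARD('v) ^ 3) * (disp z)\<^sup>2"
proof -
  note net' = net[unfolded network_assumption_def]
  have ds: "doubly_stochastic (P t)" for t using net' by blast
  have th: "theta > 0" using net' by blast
  have edge: "P t $ i $ j \<ge> theta" if "P t $ j $ i > 0" for t i j
    using net' that unfolding weight_edges_def by blast
  have diag: "P t $ i $ i \<ge> theta" for t i using net' by blast
  define N where "N = real CARD('v)"
  have N: "N \<ge> 1" unfolding N_def by (simp add: Suc_leI)
  define A where "A = range z"
  define m where "m = Min A"
  define M where "M = Max A"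
  have fin: "finite A" "A \<noteq> {}" by (auto simp: A_def)
  have mM: "m \<in> A" "M \<in> A" "\<And>i. m \<le> z i" "\<And>i. z i \<le> M"
    using fin by (auto simp: m_def M_def A_def)
  \<comment> \<open>Popoviciu's bound, obtained by centring at the midrange instead of the
    mean.\<close>
  have V: "(disp z)\<^sup>2 \<le> N * (M - m)\<^sup>2 / 4"
  proof -
    have "(norm (z i - (m + M) / 2))\<^sup>2 \<le> ((M - m) / 2)\<^sup>2" for i
      unfolding real_norm_def power2_abs
      by (rule power2_le_iff_abs_le[THEN iffD2]) (use mM(3)[of i] mM(4)[of i] in \<open>auto simp: abs_le_iff field_simps\<close>)
    then have "(\<Sum>i\<in>(UNIV::'v set). (norm (z i - (m + M) / 2))\<^sup>2) \<le> (\<Sum>i\<in>(UNIV::'v set). ((M - m) / 2)\<^sup>2)"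
      by (rule sum_mono)
    with disp_sq_le[of z "(m + M) / 2"] show ?thesis by (simp add: N_def power_divide)
  qed
  show ?thesis
  proof (cases "M = m")
    case True
    then have "disp z = 0" using V by simp
    then show ?thesis using disp_flow_le[of P "k * B + 1" B z] ds disp_nonneg[of "flow P (k * B + 1) B z"] by simp
  next
    case False
    then have Mm: "M > m" using mM by (metis antisym_conv2 A_def imageE order_le_less)
    \<comment> \<open>The number of gaps between distinct values is strictly below \<open>N\<close>,
      so one gap exceeds \<open>h\<close>. With \<open>V\<close> this yields
      \<open>(disp z)\<^sup>2 \<le> N ^ 3 * h\<^sup>2 / 4\<close>, the origin of the factor
      \<open>4 * theta / N ^ 3\<close>.\<close>
    define h where "h = (M - m) / N"
    obtain c where c: "card A = Suc c" using fin by (metis card_eq_0_iff not0_implies_Suc)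
    have "card A \<le> CARD('v)" unfolding A_def by (rule card_image_le) simp
    then have "real c < N" using c by (simp add: N_def)
    then have "M - m > real c * h" using mult_strict_right_mono[of "real c" N "M - m"] Mm N
      by (simp add: h_def field_simps)
    then obtain u v where uv: "u \<in> A" "v \<in> A" "v - u > h" "\<forall>z\<in>A. z \<le> u \<or> v \<le> z"
      using exists_large_gap[OF fin(1) c mM(1,2)] by blast
    have h0: "h > 0" using Mm N by (simp add: h_def)
    define S where "S = {i. z i \<ge> v}"
    have S: "z i \<le> u" if "i \<notin> S" for i using uv that unfolding S_def A_def by blast
    obtain p where p: "p \<in> S" using uv(2) by (auto simp: S_def A_def)
    obtain q where "z q = u" using uv(1) by (auto simp: A_def)
    then have q: "q \<notin> S" using uv(3) h0 by (auto simp: S_def)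
    define cross where "cross n \<longleftrightarrow> (\<exists>a b. a \<in> S \<and> b \<notin> S \<and> P (k * B + 1 + n) $ a $ b > 0)" for n
    have "\<exists>n<B. cross n"
    proof -
      have "strongly_connected
            \<lparr>verts = UNIV, arcs = (\<Union>t\<in>{k * B + 1..(k + 1) * B}. weight_edges (P t)),
             tail = fst, head = snd\<rparr>" using net' by blast
      from reachable_cut[OF this p q] obtain a b t where t: "a \<in> S" "b \<notin> S" "t \<ge> k * B + 1"
        "t \<le> (k + 1) * B" "P t $ a $ b > 0" by (auto simp: weight_edges_def)
      then have "cross (t - (k * B + 1))" unfolding cross_def by auto
      moreover have "t - (k * B + 1) < B" using t by (simp add: algebra_simps)
      ultimately show ?thesis by blast
    qed
    then obtain n where n: "n < B" "cross n" "\<And>n'. n' < n \<Longrightarrow> \<not> cross n'"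
      using exists_least_iff[of "\<lambda>n. n < B \<and> cross n"] by (metis order.strict_trans)
    have inv: "(\<forall>i\<in>S. flow P (k * B + 1) n' z i \<ge> v) \<and> (\<forall>i\<in>-S. flow P (k * B + 1) n' z i \<le> u)"
      if "n' \<le> n" for n'
      using that
    proof (induction n')
      case 0 then show ?case using S by (auto simp: S_def)
    next
      case (Suc n')
      let ?A = "P (k * B + 1 + n')"
      have "\<not> cross n'" using n Suc by simp
      then have nc: "\<not> ?A $ a $ b > 0" "\<not> ?A $ b $ a > 0" if "a \<in> S" "b \<notin> S" for a b
        using that edge[of "k * B + 1 + n'" b a] th unfolding cross_def by (meson less_le_trans)+
      show ?case using Suc nc
        by (auto intro!: mix_ge[OF ds] mix_le[OF ds])
    qed
    obtain a b where ab: "a \<in> S" "b \<notin> S" "P (k * B + 1 + n) $ a $ b > 0" using n(2) cross_def by blast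
    define zn where "zn = flow P (k * B + 1) n z"
    have "v \<le> zn a" "zn b \<le> u" using inv[OF order_refl] ab unfolding zn_def by auto
    then have "h \<le> zn a - zn b" using uv(3) by linarith
    then have hh: "h\<^sup>2 \<le> (zn a - zn b)\<^sup>2" using h0 by (intro power_mono) auto
    have ba: "P (k * B + 1 + n) $ b $ a \<ge> theta" by (rule edge[OF ab(3)])
    have "(disp (mix (P (k * B + 1 + n)) zn))\<^sup>2 \<le> (disp zn)\<^sup>2 - theta * (zn a - zn b)\<^sup>2"
    proof (rule disp_mix_edge[OF ds _ diag _ ba diag])
      show "a \<noteq> b" using ab by auto
      show "P (k * B + 1 + n) $ a $ b \<ge> theta" by (rule edge) (use ba th in linarith)
      show "0 \<le> theta" using th by simp
    qed
    moreover have "theta * h\<^sup>2 \<le> theta * (zn a - zn b)\<^sup>2" using hh th by (intro mult_left_mono) auto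
    ultimately have 1: "(disp (flow P (k * B + 1) (Suc n) z))\<^sup>2 \<le> (disp zn)\<^sup>2 - theta * h\<^sup>2"
      unfolding flow.simps zn_def by linarith
    have 2: "(disp zn)\<^sup>2 \<le> (disp z)\<^sup>2" unfolding zn_def
      by (intro power_mono disp_flow_le ds disp_nonneg)
    have 3: "(disp (flow P (k * B + 1) B z))\<^sup>2 \<le> (disp (flow P (k * B + 1) (Suc n) z))\<^sup>2"
      using n(1) by (intro power_mono disp_flow_antimono ds disp_nonneg) auto
    have "(disp z)\<^sup>2 \<le> N ^ 3 * h\<^sup>2 / 4" using V N by (simp add: h_def power_divide power3_eq_cube power2_eq_square)
    then have "4 * theta / N ^ 3 * (disp z)\<^sup>2 \<le> 4 * theta / N ^ 3 * (N ^ 3 * h\<^sup>2 / 4)"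
      using th N by (intro mult_left_mono) auto
    then have "4 * theta / N ^ 3 * (disp z)\<^sup>2 \<le> theta * h\<^sup>2" using N by simp
    with 1 2 3 show ?thesis by (simp add: N_def algebra_simps)
  qed
qed

text \<open>The scalar factor is the same for all coordinates and passes to their sum;
  \<open>1 - 2 * e \<le> (1 - e)\<^sup>2\<close> takes the root. Having two agents forces
  \<open>e \<le> 1\<close>, so that \<open>1 - e\<close> is nonnegative and the squares can be
  removed.\<close>

lemma disp_flow_window:
  fixes z :: "'v::finite \<Rightarrow> 'a::euclidean_space"
  assumes net: "network_assumption P B theta" and N: "CARD('v) \<ge> 2"
  shows "disp (flow P (k * B + 1) B z) \<le> (1 - 2 * theta / real CARD('v) ^ 3) * disp z"
proof -
  define e where "e = 2 * theta / real CARD('v) ^ 3"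
  have "(disp (flow P (k * B + 1) B z))\<^sup>2
      = (\<Sum>b\<in>Basis. (disp (flow P (k * B + 1) B (\<lambda>i. inner (z i) b)))\<^sup>2)"
    by (simp only: disp_sq_components[of "flow P (k * B + 1) B z"] inner_flow)
  also have "\<dots> \<le> (\<Sum>b\<in>Basis. (1 - 2 * e) * (disp (\<lambda>i. inner (z i) b))\<^sup>2)"
    by (intro sum_mono) (use disp_flow_window_real[OF net] in \<open>simp add: e_def\<close>)
  also have "\<dots> = (1 - 2 * e) * (disp z)\<^sup>2"
    by (simp only: disp_sq_components[of z] sum_distrib_left)
  also have "\<dots> \<le> (1 - e)\<^sup>2 * (disp z)\<^sup>2"
    by (intro mult_right_mono) (auto simp: power2_eq_square algebra_simps)
  finally have 1: "(disp (flow P (k * B + 1) B z))\<^sup>2 \<le> ((1 - e) * disp z)\<^sup>2" by (simp add: power_mult_distrib)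
  have "theta < 1" using net by (simp add: network_assumption_def)
  moreover have "(2::real) ^ 3 \<le> real CARD('v) ^ 3" using N by (intro power_mono) auto
  ultimately have "e \<le> 1" by (simp add: e_def field_simps)
  then have "0 \<le> (1 - e) * disp z" using disp_nonneg[of z] by simp
  with 1 show ?thesis unfolding e_def[symmetric] by (rule power2_le_imp_le)
qed

text \<open>Only the total dispersion is needed. Contraction by \<open>1 - e\<close> bounds the
  value at a window start by its drop over the window divided by \<open>e\<close>; monotonicity
  charges this value \<open>B\<close> times, and the drops telescope. The summand \<open>1\<close>
  pays for the at most \<open>B\<close> steps before the first full window.\<close>

lemma sum_disp_flow_le:
  fixes z :: "'v::finite \<Rightarrow> 'a::euclidean_space"
  assumes net: "network_assumption P B theta" and N: "CARD('v) \<ge> 2"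
  shows "(\<Sum>n<m. disp (flow P s n z)) \<le> real B * (1 + real CARD('v) ^ 3 / (2 * theta)) * disp z"
proof -
  have ds: "doubly_stochastic (P t)" for t using net by (simp add: network_assumption_def)
  have B: "B \<ge> 1" and th: "theta > 0" using net by (auto simp: network_assumption_def)
  define w where "w n = disp (flow P s n z)" for n
  have w0: "w n \<ge> 0" for n by (simp add: w_def disp_nonneg)
  have anti: "w n' \<le> w n" if "n \<le> n'" for n n'
    unfolding w_def by (rule disp_flow_antimono[OF ds that])
  \<comment> \<open>The ceiling of \<open>s / B\<close>: windows start at a multiple of
    \<open>B\<close> plus one, and \<open>k0 * B + 1\<close> is the first start strictly after
    \<open>s\<close>, at distance \<open>p\<close>.\<close>
  define k0 where "k0 = (s + B - 1) div B"
  define p where "p = k0 * B + 1 - s"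
  define e where "e = 2 * theta / real CARD('v) ^ 3"
  have e: "e > 0" using th by (simp add: e_def)
  have k0: "s \<le> k0 * B" "k0 * B + 1 \<le> s + B"
  proof -
    have "(s + B - 1) mod B < B" using B by simp
    moreover have "k0 * B + (s + B - 1) mod B = s + B - 1" unfolding k0_def by (rule div_mult_mod_eq)
    ultimately show "s \<le> k0 * B" "k0 * B + 1 \<le> s + B" using B by linarith+
  qed
  have p: "p \<le> B" "s + p = k0 * B + 1" using k0 by (auto simp: p_def)
  have step: "w (p + j * B + B) \<le> (1 - e) * w (p + j * B)" for j
  proof -
    have "s + (p + j * B) = (k0 + j) * B + 1" using p(2) by (simp add: algebra_simps)
    then show ?thesis unfolding w_def flow_flow[of P s "p + j * B" B]
      using disp_flow_window[OF net N, of "k0 + j"] by (simp add: e_def)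
  qed
  have main: "(\<Sum>n<p + j * B. w n) \<le> real B * w 0 + real B / e * (w 0 - w (p + j * B))" for j
  proof (induction j)
    case 0
    have "(\<Sum>n<p. w n) \<le> (\<Sum>n<p. w 0)" by (intro sum_mono anti) simp
    also have "\<dots> \<le> real B * w 0" using p w0 by (simp add: mult_right_mono)
    also have "\<dots> \<le> real B * w 0 + real B / e * (w 0 - w p)" using e anti[of 0 p] by simp
    finally show ?case by simp
  next
    case (Suc j)
    have "(\<Sum>n<p + Suc j * B. w n) = (\<Sum>n<p + j * B. w n) + (\<Sum>n=p + j * B..<p + Suc j * B. w n)"
      using sum.atLeastLessThan_concat[of 0 "p + j * B" "p + Suc j * B" w] by (simp add: atLeast0LessThan)
    also have "(\<Sum>n=p + j * B..<p + Suc j * B. w n) \<le> (\<Sum>n=p + j * B..<p + Suc j * B. w (p + j * B))"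
      by (intro sum_mono anti) simp
    also have "\<dots> = real B * w (p + j * B)" by simp
    also have "\<dots> \<le> real B / e * (w (p + j * B) - w (p + Suc j * B))"
    proof -
      have "e * w (p + j * B) \<le> w (p + j * B) - w (p + Suc j * B)"
        using step[of j] by (simp add: algebra_simps)
      then have "w (p + j * B) \<le> (w (p + j * B) - w (p + Suc j * B)) / e" using e by (simp add: field_simps)
      then show ?thesis using mult_left_mono[of _ _ "real B"] by fastforce
    qed
    finally show ?case using Suc by (simp add: algebra_simps)
  qed
  have "m \<le> p + m * B" using B by (simp add: trans_le_add2)
  then have "(\<Sum>n<m. w n) \<le> (\<Sum>n<p + m * B. w n)" by (intro sum_mono2) (auto intro: w0)
  also have "\<dots> \<le> real B * w 0 + real B / e * (w 0 - w (p + m * B))" by (rule main)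
  also have "\<dots> \<le> real B * w 0 + real B / e * w 0" using e w0 by (intro add_left_mono mult_left_mono) auto
  also have "\<dots> = real B * (1 + real CARD('v) ^ 3 / (2 * theta)) * disp z"
    by (simp add: w_def e_def algebra_simps)
  finally show ?thesis by (simp add: w_def)
qed

section \<open>Averaging with perturbations\<close>

lemma mix_sum: "mix A (\<lambda>i. \<Sum>k\<in>K. a k i) i = (\<Sum>k\<in>K. mix A (a k) i)"
  unfolding mix_def scaleR_sum_right by (rule sum.swap)

text \<open>Discrete variation of constants: the perturbation of time \<open>s + k\<close> enters
  the state at time \<open>s + k + 1\<close>, hence it flows for \<open>n - Suc k\<close>
  steps.\<close>

lemma perturbed_flow:
  assumes "\<And>t. x (Suc t) = (\<lambda>i. mix (P t) (x t) i + dl t i)"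
  shows "x (s + n) = (\<lambda>i. flow P s n (x s) i + (\<Sum>k<n. flow P (Suc (s + k)) (n - Suc k) (dl (s + k)) i))"
proof (induction n)
  case (Suc n)
  have "flow P (Suc (s + k)) (Suc n - Suc k) (dl (s + k)) = mix (P (s + n)) (flow P (Suc (s + k)) (n - Suc k) (dl (s + k)))"
    if kn: "k < n" for k
  proof -
    obtain j where "n = Suc (k + j)" using less_imp_Suc_add[OF kn] by blast
    then show ?thesis by (simp add: Suc_diff_le add.assoc)
  qed
  moreover have "mix (P (s + n)) (x (s + n)) = (\<lambda>i. mix (P (s + n)) (flow P s n (x s)) i
      + (\<Sum>k<n. mix (P (s + n)) (flow P (Suc (s + k)) (n - Suc k) (dl (s + k))) i))"
    by (subst Suc.IH) (simp add: mix_add mix_sum)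
  ultimately show ?case by (simp add: assms add.assoc)
qed simp

lemma disp_sum:
  assumes "finite K"
  shows "disp (\<lambda>i. \<Sum>k\<in>K. a k i) \<le> (\<Sum>k\<in>K. disp (a k))"
  using assms
proof induction
  case empty
  then show ?case by (simp add: disp_def mean_def L2_set_def)
next
  case (insert k K)
  then show ?case using disp_add[of "a k" "\<lambda>i. \<Sum>k\<in>K. a k i"] by simp
qed

text \<open>With \<open>j = n - Suc k\<close> the order of summation over the triangle is exchanged,
  so that each perturbation \<open>k\<close> is grouped with its whole later flow.\<close>

lemma triangle_sum_swap:
  "(\<Sum>n\<le>m. \<Sum>k<n. d k (n - Suc k)) = (\<Sum>k<m. \<Sum>j<m - k. d k j :: real)"
proof (induction m)
  case (Suc m)
  have "(\<Sum>k<Suc m. \<Sum>j<Suc m - k. d k j) = (\<Sum>k<Suc m. (\<Sum>j<m - k. d k j) + d k (m - k))"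
    by (intro sum.cong) (auto simp: Suc_diff_le)
  also have "\<dots> = (\<Sum>k<m. \<Sum>j<m - k. d k j) + (\<Sum>k<Suc m. d k (m - k))"
    by (simp add: sum.distrib)
  finally show ?case using Suc by simp
qed simp

text \<open>A convolution estimate: by linearity the initial state and every perturbation decay
  separately, and each is charged the same total factor once.\<close>

lemma sum_disp_perturbed_le:
  fixes x dl :: "nat \<Rightarrow> 'v::finite \<Rightarrow> 'a::euclidean_space"
  assumes net: "network_assumption P B theta" and N: "CARD('v) \<ge> 2"
    and x: "\<And>t. x (Suc t) = (\<lambda>i. mix (P t) (x t) i + dl t i)"
  shows "(\<Sum>n\<le>m. disp (x (s + n))) \<le> real B * (1 + real CARD('v) ^ 3 / (2 * theta))
           * (disp (x s) + (\<Sum>k<m. \<Sum>i\<in>UNIV. norm (dl (s + k) i)))"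
proof -
  define lam where "lam = real B * (1 + real CARD('v) ^ 3 / (2 * theta))"
  have lam: "lam \<ge> 0" using net by (simp add: lam_def network_assumption_def)
  define d where "d k j = disp (flow P (Suc (s + k)) j (dl (s + k)))" for k j
  have "disp (x (s + n)) \<le> disp (flow P s n (x s)) + (\<Sum>k<n. d k (n - Suc k))" for n
    unfolding perturbed_flow[of x, OF x, of s n] d_def
    by (rule order_trans[OF disp_add]) (intro add_left_mono disp_sum, simp)
  then have "(\<Sum>n\<le>m. disp (x (s + n))) \<le> (\<Sum>n\<le>m. disp (flow P s n (x s)) + (\<Sum>k<n. d k (n - Suc k)))"
    by (intro sum_mono)
  also have "\<dots> = (\<Sum>n<Suc m. disp (flow P s n (x s))) + (\<Sum>k<m. \<Sum>j<m - k. d k j)"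
    by (simp add: sum.distrib triangle_sum_swap lessThan_Suc_atMost)
  also have "\<dots> \<le> lam * disp (x s) + (\<Sum>k<m. lam * (\<Sum>i\<in>UNIV. norm (dl (s + k) i)))"
  proof (intro add_mono sum_mono)
    show "(\<Sum>n<Suc m. disp (flow P s n (x s))) \<le> lam * disp (x s)"
      unfolding lam_def by (rule sum_disp_flow_le[OF net N])
    fix k
    have "(\<Sum>j<m - k. d k j) \<le> lam * disp (dl (s + k))"
      unfolding lam_def d_def by (rule sum_disp_flow_le[OF net N])
    also have "\<dots> \<le> lam * (\<Sum>i\<in>UNIV. norm (dl (s + k) i))"
      using disp_le_sum[of "dl (s + k)" 0] lam by (intro mult_left_mono) simp_all
    finally show "(\<Sum>j<m - k. d k j) \<le> lam * (\<Sum>i\<in>UNIV. norm (dl (s + k) i))" .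
  qed
  finally show ?thesis by (simp add: lam_def sum_distrib_left distrib_left)
qed

section \<open>Subgradients and Bregman proximal steps\<close>

text \<open>A hyperplane separates the graph point from the strict epigraph. Since \<open>f\<close>
  is finite everywhere the hyperplane is not vertical, and normalising its last coefficient gives
  the subgradient.\<close>

lemma subdifferential_nonempty:
  fixes f :: "'a::euclidean_space \<Rightarrow> real"
  assumes f: "convex_on UNIV f"
  shows "\<exists>g. g \<in> subdifferential f a"
proof -
  define E where "E = {(x, t). f x < t}"
  have "convex E"
  proof (rule convexI, clarsimp simp: E_def)
    fix x s y t and u v :: real
    assume *: "f x < s" "f y < t" "0 \<le> u" "0 \<le> v" "u + v = 1"
    have "f (u *\<^sub>R x + v *\<^sub>R y) \<le> u * f x + v * f y"
      using f * unfolding convex_on_def by auto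
    also have "u * f x + v * f y < u * s + v * t"
      using * by (cases "u = 0") (auto intro!: add_less_le_mono mult_strict_left_mono mult_left_mono)
    finally show "f (u *\<^sub>R x + v *\<^sub>R y) < u * s + v * t" .
  qed
  moreover have "(a, f a + 1) \<in> E" by (simp add: E_def)
  moreover have "{(a, f a)} \<inter> E = {}" by (auto simp: E_def)
  ultimately have "\<exists>q b. q \<noteq> 0 \<and> (\<forall>z\<in>{(a, f a)}. inner q z \<le> b) \<and> (\<forall>z\<in>E. inner q z \<ge> b)"
    by (intro separating_hyperplane_sets) auto
  then obtain q b where q: "q \<noteq> 0" "inner q (a, f a) \<le> b" "\<And>z. z \<in> E \<Longrightarrow> inner q z \<ge> b"
    by blast
  obtain p c where pc: "q = (p, c)" by (cases q)
  have sep: "inner p a + c * f a \<le> inner p x + c * t" if "f x < t" for x t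
    using q(2) q(3)[of "(x, t)"] that by (simp add: pc E_def)
  have c0: "c > 0"
  proof -
    have "c \<ge> 0" using sep[of a "f a + 1"] by (simp add: algebra_simps)
    \<comment> \<open>If \<open>c = 0\<close>, the point \<open>a - p\<close> violates the
      separation unless \<open>p = 0\<close> as well, and then the whole normal would
      vanish.\<close>
    moreover have "c \<noteq> 0"
    proof
      assume c: "c = 0"
      then have "inner p a \<le> inner p (a - p)" using sep[of "a - p" "f (a - p) + 1"] by simp
      then have "inner p p \<le> 0" by (simp add: inner_diff_right)
      then have "p = 0" using inner_ge_zero[of p] by (metis antisym inner_eq_zero_iff)
      with c q(1) pc show False by (simp add: zero_prod_def)
    qed
    ultimately show ?thesis by simp
  qed
  have "f x \<ge> f a + inner (- (1 / c) *\<^sub>R p) (x - a)" for x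
  proof -
    have "f a - inner p (x - a) / c \<le> f x"
    proof (rule field_le_epsilon)
      fix e :: real assume "e > 0"
      then have "inner p a + c * f a \<le> inner p x + c * (f x + e)" by (intro sep) simp
      then show "f a - inner p (x - a) / c \<le> f x + e"
        using c0 by (simp add: field_simps inner_diff_right)
    qed
    then show ?thesis by simp
  qed
  then show ?thesis unfolding subdifferential_def by blast
qed

text \<open>\<open>Sup\<close> bounds the members only if the set is bounded above, so that is the
  real claim. A unit step along a subgradient raises \<open>chi i\<close> by at least the norm of
  the subgradient and stays in \<open>X\<close> plus the unit ball, a compact set on which
  \<open>chi i\<close> is bounded.\<close>

lemma subgradient_norm_le:
  fixes chi :: "'v::finite \<Rightarrow> 'a::euclidean_space \<Rightarrow> real"
  assumes chi: "convex_on UNIV (chi i)" and X: "compact X" "x \<in> X"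
    and g: "g \<in> subdifferential (chi i) x"
  shows "norm g \<le> max_subgradient_norm X chi"
proof -
  define K where "K = {x + y | x y. x \<in> X \<and> y \<in> cball 0 (1::real)}"
  have "compact K" unfolding K_def by (intro compact_sums X compact_cball)
  moreover have "continuous_on K (chi i)"
    using convex_on_continuous[OF open_UNIV chi] continuous_on_subset by blast
  ultimately have "bounded (chi i ` K)" by (intro compact_imp_bounded compact_continuous_image)
  then obtain b where b: "\<And>z. z \<in> K \<Longrightarrow> \<bar>chi i z\<bar> \<le> b" unfolding bounded_iff by auto
  let ?S = "{norm g | g x. x \<in> X \<and> g \<in> subdifferential (chi i) x}"
  have "norm g \<le> 2 * b" if "x \<in> X" "g \<in> subdifferential (chi i) x" for g x
  proof (cases "g = 0")
    case True
    have "x + 0 \<in> K" unfolding K_def using that by force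
    then show ?thesis using b[of x] True by simp
  next
    case False
    let ?y = "x + g /\<^sub>R norm g"
    have "x + 0 \<in> K" "?y \<in> K" unfolding K_def using that False by (force, fastforce)
    moreover have "chi i ?y \<ge> chi i x + inner g (?y - x)"
      using that(2) unfolding subdifferential_def by blast
    moreover have "inner g (?y - x) = norm g" using False by (simp add: power2_norm_eq_inner[symmetric] power2_eq_square)
    ultimately show ?thesis using b[of x] b[of ?y] by simp
  qed
  then have "bdd_above ?S" by (auto intro!: bdd_aboveI[where M = "2 * b"])
  then have "norm g \<le> Sup ?S" using X g by (intro cSup_upper) auto
  also have "\<dots> \<le> max_subgradient_norm X chi" unfolding max_subgradient_norm_def by (rule Max_ge) auto
  finally show ?thesis .
qed

lemma max_subgradient_norm_nonneg:
  fixes chi :: "'v::finite \<Rightarrow> 'a::euclidean_space \<Rightarrow> real"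
  assumes "convex_on UNIV (chi i)" "compact X" "x \<in> X"
  shows "max_subgradient_norm X chi \<ge> 0"
  using subdifferential_nonempty[OF assms(1), of x] subgradient_norm_le[where chi = chi and i = i, OF assms]
  by (meson norm_ge_zero order_trans)

lemma diff_le_max_subgradient_norm:
  fixes chi :: "'v::finite \<Rightarrow> 'a::euclidean_space \<Rightarrow> real"
  assumes "convex_on UNIV (chi i)" "compact X" "x \<in> X"
  shows "chi i x - chi i z \<le> max_subgradient_norm X chi * norm (x - z)"
proof -
  obtain g where g: "g \<in> subdifferential (chi i) x" using subdifferential_nonempty[OF assms(1)] by blast
  then have "chi i x - chi i z \<le> inner g (x - z)" by (auto simp: subdifferential_def inner_diff_right algebra_simps)
  also have "\<dots> \<le> norm g * norm (x - z)" by (rule norm_cauchy_schwarz)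
  also have "\<dots> \<le> max_subgradient_norm X chi * norm (x - z)"
    by (intro mult_right_mono subgradient_norm_le[where chi = chi and i = i, OF assms g]) auto
  finally show ?thesis .
qed

section \<open>Bregman geometry and estimates for one proximal step\<close>

lemma le_add_of_sq_le:
  fixes u a b :: real
  assumes "u\<^sup>2 \<le> a\<^sup>2 + b * u" "a \<ge> 0" "b \<ge> 0"
  shows "u \<le> a + b"
proof (rule ccontr)
  assume "\<not> ?thesis"
  then have u: "u > a + b" by simp
  have "a * a \<le> a * u" using u assms by (intro mult_left_mono) auto
  moreover have "(a + b) * u < u * u" using u assms by (intro mult_strict_right_mono) auto
  ultimately show False using assms(1) by (simp add: power2_eq_square algebra_simps)
qed

lemma AM_GM_scaled:
  fixes u v p :: real
  assumes "p > 0"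
  shows "u * v \<le> p * u\<^sup>2 + v\<^sup>2 / (4 * p)"
proof -
  have "0 \<le> (2 * p * u - v)\<^sup>2" by simp
  then have "4 * p * (u * v) \<le> 4 * p * (p * u\<^sup>2) + v\<^sup>2" by (simp add: power2_eq_square algebra_simps)
  then show ?thesis using assms by (simp add: field_simps power2_eq_square)
qed

text \<open>\<open>d\<close> is the bound on the Euclidean diameter of \<open>X\<close> that strong
  convexity derives from \<open>D\<close>. Through \<open>D\<^sup>2 = sigma * d\<^sup>2 / 2\<close>,
  costs expressed in \<open>d\<close> can be paid by C2.\<close>

locale mirror =
  fixes X :: "'a::euclidean_space set" and Phi dPhi and sigma L D d :: real
  assumes X: "convex X" "compact X" "X \<noteq> {}"
    and mm: "mirror_map Phi dPhi sigma" and lip: "L-lipschitz_on UNIV dPhi"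
    and D: "D = bregman_diameter Phi dPhi X"
    and d: "d = sqrt (2 / sigma) * D"
begin

abbreviation "breg \<equiv> bregman Phi dPhi"

lemma sigma: "sigma > 0" using mm by (simp add: mirror_map_def)

lemma L_nonneg: "L \<ge> 0" using lip by (rule lipschitz_on_nonneg)

lemma bregman_ge: "breg a b \<ge> sigma / 2 * (norm (a - b))\<^sup>2"
proof -
  have "Phi a \<ge> Phi b + inner (dPhi b) (a - b) + sigma / 2 * (norm (a - b))\<^sup>2"
    using mm unfolding mirror_map_def by blast
  then show ?thesis by (simp add: bregman_def)
qed

lemma bregman_nonneg: "breg a b \<ge> 0"
proof -
  have "sigma / 2 * (norm (a - b))\<^sup>2 \<ge> 0" using sigma by simp
  with bregman_ge[of a b] show ?thesis by linarith
qed

lemma bregman_three_point: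
  "breg a c = breg a b + breg b c + inner (dPhi b - dPhi c) (a - b)"
  by (simp add: bregman_def inner_diff_left inner_diff_right algebra_simps)

lemma grad_diff: "norm (dPhi a - dPhi b) \<le> L * norm (a - b)"
  using lipschitz_onD[OF lip, of a b] by (simp add: dist_norm)

lemma inner_grad_le: "inner (dPhi a - dPhi b) v \<le> L * norm (a - b) * norm v"
  using norm_cauchy_schwarz[of "dPhi a - dPhi b" v] mult_right_mono[OF grad_diff[of a b], of "norm v"] by simp

text \<open>The symmetrised divergence is an inner product of differences. Dropping the nonnegative
  reversed divergence leaves the constant \<open>L\<close> without integrating along a
  segment.\<close>

lemma bregman_le: "breg a b \<le> L * (norm (a - b))\<^sup>2"
proof -
  have "breg a b + breg b a = inner (dPhi a - dPhi b) (a - b)"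
    by (simp add: bregman_def inner_diff_left inner_diff_right algebra_simps)
  also have "\<dots> \<le> L * (norm (a - b))\<^sup>2" using inner_grad_le[of a b "a - b"] by (simp add: power2_eq_square)
  finally show ?thesis using bregman_nonneg[of b a] by simp
qed

lemma bregman_le_D:
  assumes "a \<in> X" "b \<in> X"
  shows "breg a b \<le> D\<^sup>2"
proof -
  let ?S = "{breg x y | x y. x \<in> X \<and> y \<in> X}"
  have "breg x y \<le> L * (diameter X)\<^sup>2" if "x \<in> X" "y \<in> X" for x y
  proof -
    have "norm (x - y) \<le> diameter X"
      using diameter_bounded_bound[OF compact_imp_bounded[OF X(2)] that] by (simp add: dist_norm)
    then have "L * (norm (x - y))\<^sup>2 \<le> L * (diameter X)\<^sup>2" by (intro mult_left_mono power_mono L_nonneg) auto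
    with bregman_le[of x y] show ?thesis by linarith
  qed
  then have "bdd_above ?S" by (auto intro!: bdd_aboveI[where M = "L * (diameter X)\<^sup>2"])
  then have le: "breg a b \<le> Sup ?S" using assms by (intro cSup_upper) auto
  then have "Sup ?S \<ge> 0" using bregman_nonneg[of a b] by linarith
  then have "D\<^sup>2 = Sup ?S" by (simp add: D bregman_diameter_def)
  with le show ?thesis by simp
qed

lemma D_nonneg: "D \<ge> 0"
proof -
  obtain a where a: "a \<in> X" using X by blast
  let ?S = "{breg x y | x y. x \<in> X \<and> y \<in> X}"
  have "breg a a \<le> D\<^sup>2" using a by (rule bregman_le_D[OF a])
  have "\<not> D < 0"
  proof
    assume "D < 0"
    \<comment> \<open>\<open>sqrt\<close> is odd on the reals, so a negative supremum would give a
      negative \<open>D\<close>.\<close>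
    then have neg: "Sup ?S < 0" by (simp add: D bregman_diameter_def)
    have "breg x y \<le> D\<^sup>2" if "x \<in> X" "y \<in> X" for x y using bregman_le_D that by blast
    then have "bdd_above ?S" by (auto intro!: bdd_aboveI[where M = "D\<^sup>2"])
    then have "breg a a \<le> Sup ?S" using a by (intro cSup_upper) auto
    with neg bregman_nonneg[of a a] show False by linarith
  qed
  then show ?thesis by simp
qed

lemma d_nonneg: "d \<ge> 0" using D_nonneg sigma by (simp add: d)

lemma D_sq: "D\<^sup>2 = sigma * d\<^sup>2 / 2"
  using sigma by (simp add: d power_mult_distrib)

lemma norm_le_d:
  assumes "a \<in> X" "b \<in> X"
  shows "norm (a - b) \<le> d"
proof -
  have "sigma / 2 * (norm (a - b))\<^sup>2 \<le> sigma / 2 * d\<^sup>2"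
    using bregman_ge[of a b] bregman_le_D[OF assms] by (simp add: D_sq)
  then have "(norm (a - b))\<^sup>2 \<le> d\<^sup>2" using sigma by simp
  then show ?thesis using d_nonneg power2_le_imp_le by blast
qed

text \<open>Optimality is tested at \<open>p + t *\<^sub>R v\<close> with \<open>v = z - p\<close>.
  The increment of \<open>h\<close> is at most linear in \<open>t\<close> by convexity, and the
  Bregman remainder is quadratic in \<open>t\<close> by \<open>bregman_le\<close>, so the
  first-order coefficient \<open>c\<close> cannot be negative. The three-point identity turns
  \<open>0 \<le> c\<close> into the claim.\<close>

lemma prox_three_point:
  assumes p: "is_arg_min (\<lambda>z. inner g z + 1 / al * breg z y + h z) (\<lambda>z. z \<in> X) p"
    and h: "convex_on UNIV h" and al: "al > 0" and z: "z \<in> X"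
  shows "inner g p + h p + 1 / al * (breg p y + breg z p) \<le> inner g z + h z + 1 / al * breg z y"
proof -
  have pX: "p \<in> X" using p by (simp add: is_arg_min_def)
  define v where "v = z - p"
  define c where "c = inner g v + h z - h p + 1 / al * inner (dPhi p - dPhi y) v"
  have small: "0 \<le> c + t * (L * (norm v)\<^sup>2 / al)" if t: "0 < t" "t \<le> 1" for t
  proof -
    define q where "q = p + t *\<^sub>R v"
    have q: "q = (1 - t) *\<^sub>R p + t *\<^sub>R z" by (simp add: q_def v_def algebra_simps)
    then have "q \<in> X" using X(1) pX z t by (simp add: convexD_alt)
    then have "\<not> inner g q + 1 / al * breg q y + h q < inner g p + 1 / al * breg p y + h p"
      using p by (auto simp: is_arg_min_def)
    moreover have "h q \<le> (1 - t) * h p + t * h z"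
      using h t unfolding q convex_on_def by auto
    moreover have "inner g q = inner g p + t * inner g v" by (simp add: q_def inner_add_right)
    moreover have "breg q y - breg p y = breg q p + t * inner (dPhi p - dPhi y) v"
      using bregman_three_point[of q y p] by (simp add: q_def)
    then have "1 / al * breg q y - 1 / al * breg p y = 1 / al * breg q p + t * (1 / al * inner (dPhi p - dPhi y) v)"
      by (simp add: right_diff_distrib[symmetric] distrib_left divide_simps)
    moreover have "1 / al * breg q p \<le> t * (t * (L * (norm v)\<^sup>2 / al))"
      using mult_left_mono[OF bregman_le[of q p], of "1 / al"] al
      by (simp add: q_def power_mult_distrib power2_eq_square algebra_simps)
    ultimately have "0 \<le> t * (c + t * (L * (norm v)\<^sup>2 / al))"
      by (simp add: c_def algebra_simps)
    then show ?thesis using t by (simp add: zero_le_mult_iff)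
  qed
  have "0 \<le> c"
  proof (rule ccontr)
    assume "\<not> 0 \<le> c"
    define b where "b = L * (norm v)\<^sup>2 / al"
    have b: "b \<ge> 0" using L_nonneg al by (simp add: b_def)
    \<comment> \<open>Chosen so that the remainder \<open>t * b\<close> is at most
      \<open>- c / 2\<close>, which contradicts \<open>small\<close>; \<open>b + 1\<close> keeps the
      denominator positive.\<close>
    define t where "t = min 1 (- c / (2 * (b + 1)))"
    have t: "0 < t" "t \<le> 1" using \<open>\<not> 0 \<le> c\<close> b by (auto simp: t_def divide_less_0_iff)
    have "t * b \<le> (- c / (2 * (b + 1))) * (b + 1)"
      using b t \<open>\<not> 0 \<le> c\<close> by (intro mult_mono) (auto simp: t_def)
    also have "\<dots> = - c / 2" using b by (simp add: field_simps)
    finally show False using small[OF t] \<open>\<not> 0 \<le> c\<close> by (simp add: b_def)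
  qed
  moreover have "breg z y = breg z p + breg p y + inner (dPhi p - dPhi y) v"
    by (simp add: bregman_three_point[of z y p] v_def)
  then have "1 / al * breg z y = 1 / al * (breg p y + breg z p) + 1 / al * inner (dPhi p - dPhi y) v"
    by (simp add: add_divide_distrib)
  ultimately show ?thesis by (simp add: c_def v_def inner_diff_right)
qed

text \<open>The point \<open>b + e\<close> may leave \<open>X\<close>. The three-point identity
  isolates its effect: a gradient change of size \<open>L * norm e\<close> is paired with
  \<open>a - b\<close>, whose length is at most \<open>d\<close>.\<close>

lemma bregman_perturb:
  assumes "a \<in> X" "b \<in> X"
  shows "breg a (b + e) \<le> breg a b + L * (norm e)\<^sup>2 + L * d * norm e"
proof -
  have "inner (dPhi b - dPhi (b + e)) (a - b) \<le> L * norm e * norm (a - b)"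
    using inner_grad_le[of b "b + e" "a - b"] by simp
  also have "\<dots> \<le> L * norm e * d" by (intro mult_left_mono norm_le_d assms mult_nonneg_nonneg L_nonneg) auto
  finally show ?thesis
    using bregman_three_point[of a "b + e" b] bregman_le[of b "b + e"] by (simp add: mult.commute mult.left_commute)
qed

text \<open>The reference point is the feasible point w, not the query point w + e, which need not be in X.\<close>
lemma prox_displacement:
  assumes p: "is_arg_min (\<lambda>z. inner g z + 1 / al * breg z (w + e) + h z) (\<lambda>z. z \<in> X) p"
    and h: "convex_on UNIV h" and al: "al > 0" and w: "w \<in> X"
    and H: "h w - h p \<le> H * norm (w - p)" "H \<ge> 0"
  shows "norm (p - w) \<le> 2 * al * (norm g + H) / sigma + sqrt (2 * L / sigma) * norm e"
proof -
  define u where "u = norm (p - w)"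
  have "1 / al * (breg p (w + e) + breg w p) \<le> inner g (w - p) + (h w - h p) + 1 / al * breg w (w + e)"
    using prox_three_point[OF p h al w] by (simp add: inner_diff_right)
  also have "\<dots> \<le> (norm g + H) * u + 1 / al * (L * (norm e)\<^sup>2)"
    using norm_cauchy_schwarz[of g "w - p"] H(1) bregman_le[of w "w + e"] al
    by (simp add: u_def norm_minus_commute distrib_right add_mono divide_right_mono)
  finally have "al * (1 / al * (breg p (w + e) + breg w p)) \<le> al * ((norm g + H) * u + 1 / al * (L * (norm e)\<^sup>2))"
    using al by (intro mult_left_mono) auto
  then have "breg p (w + e) + breg w p \<le> al * ((norm g + H) * u) + L * (norm e)\<^sup>2"
    using al by (simp add: distrib_left)
  moreover have "sigma / 2 * u\<^sup>2 \<le> breg w p" using bregman_ge[of w p] by (simp add: u_def norm_minus_commute)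
  ultimately have "sigma / 2 * u\<^sup>2 \<le> al * ((norm g + H) * u) + L * (norm e)\<^sup>2"
    using bregman_nonneg[of p "w + e"] by linarith
  then have "u\<^sup>2 \<le> 2 * L / sigma * (norm e)\<^sup>2 + 2 * al * (norm g + H) / sigma * u"
    using sigma by (simp add: field_simps)
  also have "2 * L / sigma * (norm e)\<^sup>2 = (sqrt (2 * L / sigma) * norm e)\<^sup>2"
    using L_nonneg sigma by (simp add: power_mult_distrib)
  finally have "u \<le> sqrt (2 * L / sigma) * norm e + 2 * al * (norm g + H) / sigma"
    by (rule le_add_of_sq_le) (use L_nonneg sigma al H in auto)
  then show ?thesis by (simp add: u_def)
qed

text \<open>The term quadratic in the step length that the prox inequality provides also pays for
  moving f from y to p, so no separate bound on the step from y is needed.\<close>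
lemma prox_step_regret:
  assumes p: "is_arg_min (\<lambda>z. inner gt z + 1 / al * breg z y + chi z) (\<lambda>z. z \<in> X) p"
    and chi: "convex_on UNIV chi" and al: "al > 0" and xs: "xs \<in> X"
    and m: "m \<in> subdifferential f y" and g: "g \<in> subdifferential f xl" "norm g \<le> Gf"
    and H: "chi xl - chi p \<le> H * norm (xl - p)"
  shows "f xl + chi xl - (f xs + chi xs) \<le> inner (m - gt) (y - xs) + al * ((norm gt)\<^sup>2 + Gf\<^sup>2) / sigma
           + 1 / al * (breg xs y - breg xs p) + (Gf + H) * norm (xl - p)"
proof -
  define u where "u = norm (y - p)"
  have Gf: "Gf \<ge> 0" using g(2) norm_ge_zero order_trans by blast
  have "f xl - f y \<le> inner g (xl - y)"
    using g(1) by (auto simp: subdifferential_def inner_diff_right algebra_simps)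
  also have "\<dots> \<le> Gf * norm (xl - y)"
    using norm_cauchy_schwarz[of g "xl - y"] mult_right_mono[OF g(2), of "norm (xl - y)"] by simp
  also have "\<dots> \<le> Gf * (norm (xl - p) + u)"
    using Gf norm_triangle_ineq4[of "xl - p" "y - p"] by (intro mult_left_mono) (auto simp: u_def)
  finally have 1: "f xl - f y \<le> Gf * norm (xl - p) + Gf * u" by (simp add: distrib_left)
  have 2: "f y - f xs \<le> inner m (y - xs)"
    using m by (auto simp: subdifferential_def inner_diff_right algebra_simps)
  have 3: "inner gt (p - xs) + chi p - chi xs \<le> 1 / al * (breg xs y - breg xs p) - 1 / al * breg p y"
    using prox_three_point[OF p chi al xs] by (simp add: inner_diff_right right_diff_distrib distrib_left)
  have 4: "inner gt (y - p) \<le> norm gt * u" using norm_cauchy_schwarz unfolding u_def by blast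
  have 5: "sigma / (2 * al) * u\<^sup>2 \<le> 1 / al * breg p y"
    using mult_left_mono[OF bregman_ge[of p y], of "1 / al"] al by (simp add: u_def norm_minus_commute)
  have "u * (norm gt + Gf) \<le> sigma / (2 * al) * u\<^sup>2 + (norm gt + Gf)\<^sup>2 / (4 * (sigma / (2 * al)))"
    using sigma al by (intro AM_GM_scaled) simp
  also have "(norm gt + Gf)\<^sup>2 / (4 * (sigma / (2 * al))) = al / (2 * sigma) * (norm gt + Gf)\<^sup>2"
    using sigma al by (simp add: field_simps)
  also have "\<dots> \<le> al / (2 * sigma) * (2 * ((norm gt)\<^sup>2 + Gf\<^sup>2))"
    using sigma al zero_le_power2[of "norm gt - Gf"]
    by (intro mult_left_mono) (auto simp: power2_eq_square algebra_simps)
  also have "\<dots> = al * ((norm gt)\<^sup>2 + Gf\<^sup>2) / sigma" using sigma by (simp add: field_simps)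
  finally have 6: "norm gt * u + Gf * u \<le> sigma / (2 * al) * u\<^sup>2 + al * ((norm gt)\<^sup>2 + Gf\<^sup>2) / sigma"
    by (simp add: algebra_simps)
  have 7: "inner (m - gt) (y - xs) = inner m (y - xs) - inner gt (y - p) - inner gt (p - xs)"
    by (simp add: inner_diff_left inner_diff_right)
  show ?thesis using 1 2 3 4 5 6 7 H by (simp add: distrib_right)
qed

end

section \<open>Regret and disagreement along a path\<close>

text \<open>Summation by parts: the weights increase, and every increment meets a value of at most
  \<open>K\<close>. Keeping \<open>- V T\<close> on the right lets the induction close.\<close>

lemma weighted_telescope_le:
  fixes V :: "nat \<Rightarrow> real"
  assumes "\<And>s. V s \<le> K"
  shows "(\<Sum>s<T. sqrt (real s + 1) * (V s - V (Suc s))) \<le> sqrt (real T) * (K - V T)"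
proof (induction T)
  case (Suc T)
  have "sqrt (real T) * (K - V T) \<le> sqrt (real T + 1) * (K - V T)"
    using assms[of T] by (intro mult_right_mono) auto
  with Suc show ?case by (simp add: algebra_simps)
qed simp

text \<open>One outcome is frozen, so all estimates here are deterministic: \<open>gt\<close> holds
  the sampled subgradients, and \<open>m\<close> stands for their conditional means, which are true
  subgradients at the query points.\<close>

locale dscmd_path = mirror X Phi dPhi sigma L D d
  for X :: "'a::euclidean_space set" and Phi dPhi sigma L D d +
  fixes f chi :: "'v::finite \<Rightarrow> 'a \<Rightarrow> real" and P :: "nat \<Rightarrow> real^'v^'v" and B :: nat and theta :: real
    and al r :: "nat \<Rightarrow> real" and x y gt m :: "nat \<Rightarrow> 'v \<Rightarrow> 'a" and xi :: "nat \<Rightarrow> 'v \<Rightarrow> 'v \<Rightarrow> 'a"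
    and g :: "'v \<Rightarrow> 'a \<Rightarrow> 'a" and Gf H :: real
  assumes chi: "\<And>i. convex_on UNIV (chi i)"
    and breg_convex: "\<And>a (b :: 'v \<Rightarrow> 'a) (c :: 'v \<Rightarrow> real).
           (\<forall>i. 0 \<le> c i \<and> c i \<le> 1) \<Longrightarrow> (\<Sum>i\<in>UNIV. c i) = 1 \<Longrightarrow>
           breg a (\<Sum>i\<in>UNIV. c i *\<^sub>R b i) \<le> (\<Sum>i\<in>UNIV. c i * breg a (b i))"
    and net: "network_assumption P B theta"
    and al: "\<And>t. al t = 1 / sqrt (real t + 1)"
    and r: "\<And>t. r t = 1 / (real t + 1)"
    and x0: "\<And>i. x 0 i \<in> X"
    and y: "\<And>t i. y t i = (\<Sum>j\<in>UNIV. P t $ i $ j *\<^sub>R (x t j + r t *\<^sub>R xi t i j))"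
    and x: "\<And>t i. is_arg_min (\<lambda>z. inner (gt t i) z + 1 / al t * breg z (y t i) + chi i z)
          (\<lambda>z. z \<in> X) (x (Suc t) i)"
    and m: "\<And>t i. m t i \<in> subdifferential (f i) (y t i)"
    and g: "\<And>i z. z \<in> X \<Longrightarrow> g i z \<in> subdifferential (f i) z"
    and g_norm: "\<And>i z. z \<in> X \<Longrightarrow> norm (g i z) \<le> Gf"
    and H: "\<And>i a b. a \<in> X \<Longrightarrow> chi i a - chi i b \<le> H * norm (a - b)" "H \<ge> 0"
begin

lemma P_nonneg: "P t $ i $ j \<ge> 0" and P_row: "(\<Sum>j\<in>UNIV. P t $ i $ j) = 1"
  and P_col: "(\<Sum>i\<in>UNIV. P t $ i $ j) = 1"
  using net by (auto simp: network_assumption_def doubly_stochastic_def)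

lemma P_le_1: "P t $ i $ j \<le> 1"
  unfolding P_row[of t i, symmetric] by (rule member_le_sum) (auto simp: P_nonneg)

lemma al_pos: "al t > 0" by (simp add: al)

lemma r_nonneg: "r t \<ge> 0" by (simp add: r)

lemma x_in: "x t i \<in> X"
  using x0 x by (cases t) (auto simp: is_arg_min_def)

lemma mix_in: "mix (P t) (x t) i \<in> X"
  unfolding mix_def by (rule convex_sum) (auto simp: X P_row P_nonneg x_in)

definition noise_cost :: "nat \<Rightarrow> real" where
  "noise_cost t = (\<Sum>i\<in>UNIV. \<Sum>j\<in>UNIV. P t $ i $ j *
      (L * (r t)\<^sup>2 * (norm (xi t i j))\<^sup>2 + L * d * r t * norm (xi t i j)))"

text \<open>Convexity in the second argument moves the average out of the divergence, each link then
  pays for its own noise, and unit column sums collapse the double sum.\<close>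

lemma bregman_query_le:
  assumes "a \<in> X"
  shows "(\<Sum>i\<in>UNIV. breg a (y t i)) \<le> (\<Sum>j\<in>UNIV. breg a (x t j)) + noise_cost t"
proof -
  have "(\<Sum>i\<in>UNIV. breg a (y t i)) \<le> (\<Sum>i\<in>UNIV. \<Sum>j\<in>UNIV. P t $ i $ j * breg a (x t j + r t *\<^sub>R xi t i j))"
    unfolding y by (intro sum_mono breg_convex) (auto simp: P_nonneg P_le_1 P_row)
  also have "\<dots> \<le> (\<Sum>i\<in>UNIV. \<Sum>j\<in>UNIV. P t $ i $ j * (breg a (x t j)
      + (L * (r t)\<^sup>2 * (norm (xi t i j))\<^sup>2 + L * d * r t * norm (xi t i j))))"
  proof (intro sum_mono mult_left_mono P_nonneg)
    fix i j
    show "breg a (x t j + r t *\<^sub>R xi t i j) \<le> breg a (x t j)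
      + (L * (r t)\<^sup>2 * (norm (xi t i j))\<^sup>2 + L * d * r t * norm (xi t i j))"
      using bregman_perturb[OF assms x_in, of t j "r t *\<^sub>R xi t i j"] r_nonneg[of t]
      by (simp add: power_mult_distrib mult.assoc)
  qed
  also have "\<dots> = (\<Sum>i\<in>UNIV. \<Sum>j\<in>UNIV. P t $ i $ j * breg a (x t j)) + noise_cost t"
    by (simp only: distrib_left[of "P _ $ _ $ _"] sum.distrib noise_cost_def)
  also have "(\<Sum>i\<in>UNIV. \<Sum>j\<in>UNIV. P t $ i $ j * breg a (x t j)) = (\<Sum>j\<in>UNIV. \<Sum>i\<in>UNIV. P t $ i $ j * breg a (x t j))"
    by (rule sum.swap)
  also have "\<dots> = (\<Sum>j\<in>UNIV. breg a (x t j))" by (simp add: sum_distrib_right[symmetric] P_col)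
  finally show ?thesis .
qed

text \<open>All functions are evaluated at agent \<open>l\<close>, but agent \<open>i\<close>
  performs the step for \<open>f i\<close>; this mismatch costs the distances to
  \<open>x t l\<close>. Since \<open>1 / al t = sqrt (real t + 1)\<close>, the divergences appear
  with increasing weights.\<close>

lemma regret:
  assumes xs: "xs \<in> X"
  shows "(\<Sum>t=1..T. (\<Sum>i\<in>UNIV. f i (x t l) + chi i (x t l)) - (\<Sum>i\<in>UNIV. f i xs + chi i xs))
    \<le> (\<Sum>t<T. (\<Sum>i\<in>UNIV. inner (m t i - gt t i) (y t i - xs) + al t * ((norm (gt t i))\<^sup>2 + Gf\<^sup>2) / sigma)
          + 1 / al t * noise_cost t)
      + sqrt (real T) * (real CARD('v) * D\<^sup>2)
      + (Gf + H) * (\<Sum>t=1..T. \<Sum>i\<in>UNIV. norm (x t l - x t i))"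
proof -
  define V where "V t = (\<Sum>i\<in>UNIV. breg xs (x t i))" for t
  define A where "A t = (\<Sum>i\<in>UNIV. inner (m t i - gt t i) (y t i - xs) + al t * ((norm (gt t i))\<^sup>2 + Gf\<^sup>2) / sigma)" for t
  define c where "c t = (\<Sum>i\<in>UNIV. norm (x t l - x t i))" for t
  have V: "V t \<le> real CARD('v) * D\<^sup>2" for t
    unfolding V_def using sum_mono[of UNIV "\<lambda>i. breg xs (x t i)" "\<lambda>i. D\<^sup>2"] bregman_le_D[OF xs x_in] by simp
  have V0: "V t \<ge> 0" for t unfolding V_def by (intro sum_nonneg bregman_nonneg)
  have step: "(\<Sum>i\<in>UNIV. f i (x (Suc t) l) + chi i (x (Suc t) l)) - (\<Sum>i\<in>UNIV. f i xs + chi i xs)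
     \<le> A t + 1 / al t * noise_cost t + sqrt (real t + 1) * (V t - V (Suc t)) + (Gf + H) * c (Suc t)" for t
  proof -
    have "(\<Sum>i\<in>UNIV. f i (x (Suc t) l) + chi i (x (Suc t) l)) - (\<Sum>i\<in>UNIV. f i xs + chi i xs)
      = (\<Sum>i\<in>UNIV. f i (x (Suc t) l) + chi i (x (Suc t) l) - (f i xs + chi i xs))"
      by (simp only: sum_subtractf)
    also have "\<dots> \<le> (\<Sum>i\<in>UNIV. (inner (m t i - gt t i) (y t i - xs) + al t * ((norm (gt t i))\<^sup>2 + Gf\<^sup>2) / sigma)
           + 1 / al t * (breg xs (y t i) - breg xs (x (Suc t) i)) + (Gf + H) * norm (x (Suc t) l - x (Suc t) i))"
      by (intro sum_mono prox_step_regret[OF x chi al_pos xs m g g_norm H(1)] x_in)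
    also have "\<dots> = A t + 1 / al t * ((\<Sum>i\<in>UNIV. breg xs (y t i)) - V (Suc t)) + (Gf + H) * c (Suc t)"
      by (simp only: sum.distrib A_def V_def c_def sum_distrib_left[symmetric] sum_subtractf)
    also have "\<dots> \<le> A t + 1 / al t * (V t + noise_cost t - V (Suc t)) + (Gf + H) * c (Suc t)"
      using bregman_query_le[OF xs, of t] al_pos[of t] unfolding V_def
      by (intro add_mono mult_left_mono order_refl) auto
    also have "\<dots> = A t + 1 / al t * noise_cost t + sqrt (real t + 1) * (V t - V (Suc t)) + (Gf + H) * c (Suc t)"
      by (simp add: al algebra_simps)
    finally show ?thesis .
  qed
  have "(\<Sum>t=1..T. (\<Sum>i\<in>UNIV. f i (x t l) + chi i (x t l)) - (\<Sum>i\<in>UNIV. f i xs + chi i xs))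
    = (\<Sum>t<T. (\<Sum>i\<in>UNIV. f i (x (Suc t) l) + chi i (x (Suc t) l)) - (\<Sum>i\<in>UNIV. f i xs + chi i xs))"
    unfolding One_nat_def by (rule sum.atLeast1_atMost_eq)
  also have "\<dots> \<le> (\<Sum>t<T. A t + 1 / al t * noise_cost t + sqrt (real t + 1) * (V t - V (Suc t)) + (Gf + H) * c (Suc t))"
    by (intro sum_mono step)
  also have "\<dots> = (\<Sum>t<T. A t + 1 / al t * noise_cost t) + (\<Sum>t<T. sqrt (real t + 1) * (V t - V (Suc t)))
      + (Gf + H) * (\<Sum>t=1..T. c t)"
    by (simp only: sum.distrib sum_distrib_left One_nat_def sum.atLeast1_atMost_eq)
  also have "(\<Sum>t<T. sqrt (real t + 1) * (V t - V (Suc t))) \<le> sqrt (real T) * (real CARD('v) * D\<^sup>2 - V T)"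
    by (rule weighted_telescope_le[OF V])
  also have "\<dots> \<le> sqrt (real T) * (real CARD('v) * D\<^sup>2)"
    using V0 by (intro mult_left_mono) auto
  finally show ?thesis by (simp add: A_def c_def)
qed

lemma spread_le: "(\<Sum>i\<in>UNIV. norm (x t l - x t i)) \<le> real CARD('v) * d"
  using sum_mono[of UNIV "\<lambda>i. norm (x t l - x t i)" "\<lambda>i. d"] norm_le_d[OF x_in x_in] by simp

lemma displacement_le:
  "norm (x (Suc t) i - mix (P t) (x t) i)
     \<le> 2 * al t * (norm (gt t i) + H) / sigma + sqrt (2 * L / sigma) * (r t * (\<Sum>j\<in>UNIV. P t $ i $ j * norm (xi t i j)))"
proof -
  define e where "e = (\<Sum>j\<in>UNIV. P t $ i $ j *\<^sub>R (r t *\<^sub>R xi t i j))"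
  have "y t i = mix (P t) (x t) i + e"
    by (simp add: y mix_def e_def scaleR_add_right sum.distrib)
  from prox_displacement[OF x[of t i, unfolded this] chi al_pos mix_in H(1)[OF mix_in] H(2)]
  have "norm (x (Suc t) i - mix (P t) (x t) i) \<le> 2 * al t * (norm (gt t i) + H) / sigma + sqrt (2 * L / sigma) * norm e" .
  also have "norm e \<le> (\<Sum>j\<in>UNIV. norm (P t $ i $ j *\<^sub>R (r t *\<^sub>R xi t i j)))" unfolding e_def by (rule norm_sum)
  also have "\<dots> = r t * (\<Sum>j\<in>UNIV. P t $ i $ j * norm (xi t i j))"
    using P_nonneg r_nonneg[of t] by (simp add: sum_distrib_left mult_ac)
  finally show ?thesis using L_nonneg sigma by (simp add: mult_left_mono)
qed

text \<open>Of the past before \<open>s\<close> only membership of the iterates in \<open>X\<close>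
  is kept, which gives the initial dispersion \<open>CARD('v) * d\<close>. The factor 2 arises from
  comparing two agents through their mean, and \<open>CARD('v)\<close> from the sum over
  agents.\<close>

lemma consensus:
  assumes N: "CARD('v) \<ge> 2" and s: "s < T"
  shows "(\<Sum>t=Suc s..T. \<Sum>i\<in>UNIV. norm (x t l - x t i))
    \<le> 2 * real CARD('v) * (real B * (1 + real CARD('v) ^ 3 / (2 * theta))) * (real CARD('v) * d
       + (\<Sum>t=s..<T. \<Sum>i\<in>UNIV. 2 * al t * (norm (gt t i) + H) / sigma
            + sqrt (2 * L / sigma) * (r t * (\<Sum>j\<in>UNIV. P t $ i $ j * norm (xi t i j)))))"
    (is "_ \<le> 2 * ?N * ?lam * (_ + (\<Sum>t=s..<T. \<Sum>i\<in>UNIV. ?b t i))")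
proof -
  define dl where "dl t i = x (Suc t) i - mix (P t) (x t) i" for t i
  have rec: "x (Suc t) = (\<lambda>i. mix (P t) (x t) i + dl t i)" for t by (simp add: dl_def)
  have lam: "?lam \<ge> 0" using net by (simp add: network_assumption_def)
  have sh: "(\<Sum>t=s..<T. h t) = (\<Sum>k<T - s. h (s + k))" for h :: "nat \<Rightarrow> real"
    using sum.shift_bounds_nat_ivl[of h 0 s "T - s"] s by (simp add: atLeast0LessThan add.commute)
  have "(\<Sum>t=Suc s..T. \<Sum>i\<in>UNIV. norm (x t l - x t i)) \<le> (\<Sum>t=Suc s..T. 2 * ?N * disp (x t))"
  proof (rule sum_mono)
    fix t
    show "(\<Sum>i\<in>UNIV. norm (x t l - x t i)) \<le> 2 * ?N * disp (x t)"
      using sum_mono[of UNIV "\<lambda>i. norm (x t l - x t i)" "\<lambda>i. 2 * disp (x t)"] norm_diff_le_disp[of "x t" l] by simp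
  qed
  \<comment> \<open>The term at \<open>s\<close> is added because the perturbed recursion starts
    there.\<close>
  also have "\<dots> \<le> (\<Sum>t=s..T. 2 * ?N * disp (x t))"
    by (intro sum_mono2) (auto intro!: mult_nonneg_nonneg disp_nonneg)
  also have "\<dots> = 2 * ?N * (\<Sum>n\<le>T - s. disp (x (s + n)))"
    using sum.shift_bounds_cl_nat_ivl[of "\<lambda>t. disp (x t)" 0 s "T - s"] s
    by (simp add: sum_distrib_left[symmetric] atLeast0AtMost add.commute)
  also have "\<dots> \<le> 2 * ?N * (?lam * (disp (x s) + (\<Sum>k<T - s. \<Sum>i\<in>UNIV. norm (dl (s + k) i))))"
    by (intro mult_left_mono sum_disp_perturbed_le[OF net N rec]) auto
  also have "\<dots> \<le> 2 * ?N * (?lam * (?N * d + (\<Sum>k<T - s. \<Sum>i\<in>UNIV. ?b (s + k) i)))"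
  proof (intro mult_left_mono add_mono sum_mono lam)
    have "disp (x s) \<le> (\<Sum>i\<in>UNIV. norm (x s i - x s l))" by (rule disp_le_sum)
    also have "\<dots> \<le> ?N * d" using spread_le[of s l] by (simp add: norm_minus_commute)
    finally show "disp (x s) \<le> ?N * d" .
    fix k i
    show "norm (dl (s + k) i) \<le> ?b (s + k) i" unfolding dl_def by (rule displacement_le)
  qed auto
  finally show ?thesis by (simp add: sh mult.assoc)
qed

end

section \<open>Moments of the random path\<close>

text \<open>Integrability is included because the integral of a nonintegrable function is 0, so a
  bound on the integral alone would be empty. In this form bounds compose by introduction
  rules.\<close>

definition mean_le :: "'w measure \<Rightarrow> ('w \<Rightarrow> real) \<Rightarrow> real \<Rightarrow> bool" where
  "mean_le M Z c \<longleftrightarrow> integrable M Z \<and> integral\<^sup>L M Z \<le> c"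

lemma mean_le_add: "mean_le M Y b \<Longrightarrow> mean_le M Z c \<Longrightarrow> mean_le M (\<lambda>w. Y w + Z w) (b + c)"
  by (auto simp: mean_le_def)

lemma mean_le_sum:
  "(\<And>k. k \<in> K \<Longrightarrow> mean_le M (Z k) (c k)) \<Longrightarrow> mean_le M (\<lambda>w. \<Sum>k\<in>K. Z k w) (\<Sum>k\<in>K. c k)"
  by (auto simp: mean_le_def intro: sum_mono)

lemma mean_le_cmult: "mean_le M Z c \<Longrightarrow> b \<ge> 0 \<Longrightarrow> mean_le M (\<lambda>w. b * Z w) (b * c)"
  by (auto simp: mean_le_def intro: mult_left_mono)

lemma mean_le_divide: "mean_le M Z c \<Longrightarrow> b \<ge> 0 \<Longrightarrow> mean_le M (\<lambda>w. Z w / b) (c / b)"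
  by (auto simp: mean_le_def intro: divide_right_mono)

lemma mean_leD:
  assumes "mean_le M Z c" "AE w in M. Y w \<le> Z w" "integrable M Y"
  shows "integral\<^sup>L M Y \<le> c"
  using assms integral_mono_AE[of M Y Z] by (auto simp: mean_le_def)

lemma (in prob_space) mean_le_const: "mean_le M (\<lambda>w. c) c"
  by (simp add: mean_le_def prob_space)

lemma (in prob_space) subalgebra_sigma_finite:
  assumes "subalgebra M S"
  shows "sigma_finite_subalgebra M S"
  by (intro finite_measure_subalgebra_is_sigma_finite finite_measure_subalgebra.intro
      finite_measure_subalgebra_axioms.intro assms) unfold_locales

text \<open>Integrating the conditional bound in the extended nonnegative reals yields square
  integrability first; nonnegativity of the variance then bounds the first moment.\<close>

lemma (in prob_space) cond_second_moment:
  fixes Z :: "'a \<Rightarrow> 'b::euclidean_space"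
  assumes S: "subalgebra M S" and Z: "Z \<in> borel_measurable M" and c: "c \<ge> 0"
    and le: "AE w in M. nn_cond_exp M S (\<lambda>w. ennreal ((norm (Z w))\<^sup>2)) w \<le> ennreal c"
  shows "mean_le M (\<lambda>w. (norm (Z w))\<^sup>2) c" "mean_le M (\<lambda>w. norm (Z w)) (sqrt c)"
    "integrable M Z"
proof -
  interpret sigma_finite_subalgebra M S by (rule subalgebra_sigma_finite[OF S])
  note Z[measurable]
  have "(\<integral>\<^sup>+ w. ennreal ((norm (Z w))\<^sup>2) \<partial>M) = (\<integral>\<^sup>+ w. nn_cond_exp M S (\<lambda>w. ennreal ((norm (Z w))\<^sup>2)) w \<partial>M)"
    using nn_cond_exp_intg[of "\<lambda>_. 1" "\<lambda>w. ennreal ((norm (Z w))\<^sup>2)"] by simp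
  also have "\<dots> \<le> (\<integral>\<^sup>+ w. ennreal c \<partial>M)" by (rule nn_integral_mono_AE[OF le])
  also have "\<dots> = ennreal c" by (simp add: emeasure_space_1)
  finally have nn: "(\<integral>\<^sup>+ w. ennreal ((norm (Z w))\<^sup>2) \<partial>M) \<le> ennreal c" .
  then have "(\<integral>\<^sup>+ w. ennreal ((norm (Z w))\<^sup>2) \<partial>M) < \<infinity>" by (auto intro: le_less_trans)
  then have int2: "integrable M (\<lambda>w. (norm (Z w))\<^sup>2)"
    by (intro integrableI_nonneg) auto
  then have "ennreal (expectation (\<lambda>w. (norm (Z w))\<^sup>2)) \<le> ennreal c"
    using nn by (subst nn_integral_eq_integral[symmetric]) auto
  then have E2: "expectation (\<lambda>w. (norm (Z w))\<^sup>2) \<le> c" using c by simp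
  show "mean_le M (\<lambda>w. (norm (Z w))\<^sup>2) c" using int2 E2 by (simp add: mean_le_def)
  have int1: "integrable M (\<lambda>w. norm (Z w))"
    by (rule square_integrable_imp_integrable) (use int2 in auto)
  then show "integrable M Z" by (rule integrable_norm_cancel) measurable
  have "variance (\<lambda>w. norm (Z w)) \<ge> 0" by simp
  then have "(expectation (\<lambda>w. norm (Z w)))\<^sup>2 \<le> c"
    using variance_eq[OF int1 int2] E2 by simp
  then have "expectation (\<lambda>w. norm (Z w)) \<le> sqrt c" by (rule real_le_rsqrt)
  then show "mean_le M (\<lambda>w. norm (Z w)) (sqrt c)" using int1 by (simp add: mean_le_def)
qed

lemma (in prob_space) integrable_mult_square:
  fixes Y Z :: "'a \<Rightarrow> real"
  assumes "Y \<in> borel_measurable M" "Z \<in> borel_measurable M"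
    and "integrable M (\<lambda>w. (Y w)\<^sup>2)" "integrable M (\<lambda>w. (Z w)\<^sup>2)"
  shows "integrable M (\<lambda>w. Y w * Z w)"
proof (rule Bochner_Integration.integrable_bound)
  show "integrable M (\<lambda>w. (Y w)\<^sup>2 + (Z w)\<^sup>2)" using assms by simp
  show "(\<lambda>w. Y w * Z w) \<in> borel_measurable M" using assms by simp
  have "\<bar>a * b\<bar> \<le> a\<^sup>2 + b\<^sup>2" for a b :: real
  proof -
    have "2 * (\<bar>a\<bar> * \<bar>b\<bar>) \<le> a\<^sup>2 + b\<^sup>2" using zero_le_power2[of "\<bar>a\<bar> - \<bar>b\<bar>"] by (simp add: power2_diff)
    moreover have "0 \<le> \<bar>a\<bar> * \<bar>b\<bar>" by simp
    ultimately show ?thesis unfolding abs_mult by linarith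
  qed
  then show "AE w in M. norm (Y w * Z w) \<le> norm ((Y w)\<^sup>2 + (Z w)\<^sup>2)" by simp
qed

lemma borel_measurable_component:
  fixes Z :: "'a \<Rightarrow> real^'n::finite"
  assumes "Z \<in> borel_measurable M"
  shows "(\<lambda>w. Z w $ k) \<in> borel_measurable M"
  using assms by (rule measurable_compose) (intro borel_measurable_continuous_onI continuous_intros)

lemma (in prob_space) integrable_component_square:
  fixes Z :: "'a \<Rightarrow> real^'n::finite"
  assumes [measurable]: "Z \<in> borel_measurable M" and "integrable M (\<lambda>w. (norm (Z w))\<^sup>2)"
  shows "integrable M (\<lambda>w. (Z w $ k)\<^sup>2)"
proof (rule Bochner_Integration.integrable_bound[OF assms(2)])
  show "(\<lambda>w. (Z w $ k)\<^sup>2) \<in> borel_measurable M"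
    by (intro borel_measurable_power borel_measurable_component assms(1))
  have "(Z w $ k)\<^sup>2 \<le> (norm (Z w))\<^sup>2" for w
    using power_mono[OF component_le_norm_cart[of "Z w" k], of 2] by simp
  then show "AE w in M. norm ((Z w $ k)\<^sup>2) \<le> norm ((norm (Z w))\<^sup>2)" by simp
qed

text \<open>Orthogonality of the conditional residual to \<open>S\<close>-measurable vectors, by
  pulling out the components of \<open>Y\<close>. Square integrability of both factors makes the
  products integrable.\<close>

lemma (in prob_space) cond_exp_orthogonal:
  fixes Y Z :: "'a \<Rightarrow> real^'n::finite"
  assumes S: "subalgebra M S" and Z: "Z \<in> borel_measurable M" "integrable M (\<lambda>w. (norm (Z w))\<^sup>2)"
    and Y: "Y \<in> borel_measurable S" "integrable M (\<lambda>w. (norm (Y w))\<^sup>2)"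
  shows "mean_le M (\<lambda>w. inner (vec_cond_exp M S Z w - Z w) (Y w)) 0"
proof -
  interpret sigma_finite_subalgebra M S by (rule subalgebra_sigma_finite[OF S])
  have YM: "Y \<in> borel_measurable M" using Y S measurable_from_subalg by blast
  have int: "integrable M (\<lambda>w. Y w $ k * Z w $ k)" for k
    using Z YM Y(2) by (intro integrable_mult_square integrable_component_square borel_measurable_component)
  note ce = real_cond_exp_intg[OF int borel_measurable_component[OF Y(1)] borel_measurable_component[OF Z(1)]]
  have "(\<lambda>w. inner (vec_cond_exp M S Z w - Z w) (Y w))
    = (\<lambda>w. \<Sum>k\<in>UNIV. Y w $ k * real_cond_exp M S (\<lambda>w. Z w $ k) w - Y w $ k * Z w $ k)"
    by (simp add: inner_vec_def vec_cond_exp_def fun_eq_iff algebra_simps)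
  then show ?thesis using ce int by (simp add: mean_le_def)
qed

lemma subalgebra_join_noise:
  assumes "subalgebra M S" "\<And>i j. xi i j \<in> borel_measurable M"
  shows "subalgebra M (join_noise M S xi)" "sets S \<subseteq> sets (join_noise M S xi)"
    "space (join_noise M S xi) = space M" "xi i j \<in> borel_measurable (join_noise M S xi)"
proof -
  let ?A = "sets S \<union> {xi i j -` A \<inter> space M | i j A. A \<in> sets borel}"
  have SM: "sets S \<subseteq> sets M" using assms by (simp add: subalgebra_def)
  have AM: "?A \<subseteq> sets M" using SM measurable_sets[OF assms(2)] by auto
  have Pow: "?A \<subseteq> Pow (space M)" using AM sets.space_closed by blast
  have sets: "sets (join_noise M S xi) = sigma_sets (space M) ?A"
    unfolding join_noise_def using Pow by (rule sets_measure_of)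
  show sp: "space (join_noise M S xi) = space M"
    unfolding join_noise_def using Pow by (rule space_measure_of)
  show "subalgebra M (join_noise M S xi)"
    unfolding subalgebra_def sp sets using sets.sigma_sets_subset[OF AM] by simp
  show "sets S \<subseteq> sets (join_noise M S xi)" unfolding sets by auto
  show "xi i j \<in> borel_measurable (join_noise M S xi)"
    by (rule measurableI) (auto simp: sp sets)
qed

lemma convex_on_sum_fun:
  assumes "finite K" "\<And>k. k \<in> K \<Longrightarrow> convex_on UNIV (h k)"
  shows "convex_on UNIV (\<lambda>z. \<Sum>k\<in>K. h k z)"
  using assms by (induction K) (auto simp: convex_on_const)

section \<open>The random iteration: measurability, moments and expected bounds\<close>

locale dscmd = prob_space M + mirror X Phi dPhi sigma L D d
  for M :: "'w measure" and X :: "(real^'n::finite) set" and Phi dPhi sigma L D d +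
  fixes Fil :: "int \<Rightarrow> 'w measure"
    and f chi :: "'v::finite \<Rightarrow> real^'n \<Rightarrow> real" and g :: "'v \<Rightarrow> real^'n \<Rightarrow> real^'n"
    and P :: "nat \<Rightarrow> real^'v^'v" and B :: nat and theta :: real and al r :: "nat \<Rightarrow> real"
    and xi :: "nat \<Rightarrow> 'v \<Rightarrow> 'v \<Rightarrow> 'w \<Rightarrow> real^'n" and G :: "nat \<Rightarrow> 'v \<Rightarrow> real^'n \<Rightarrow> 'w \<Rightarrow> real^'n"
    and x0 :: "'v \<Rightarrow> real^'n" and x y :: "nat \<Rightarrow> 'v \<Rightarrow> 'w \<Rightarrow> real^'n" and Gf nu :: real
  assumes f: "\<And>i. convex_on UNIV (f i)" and chi: "\<And>i. convex_on UNIV (chi i)"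
    and breg_convex: "\<And>a (b :: 'v \<Rightarrow> real^'n) (c :: 'v \<Rightarrow> real).
           (\<forall>i. 0 \<le> c i \<and> c i \<le> 1) \<Longrightarrow> (\<Sum>i\<in>UNIV. c i) = 1 \<Longrightarrow>
           breg a (\<Sum>i\<in>UNIV. c i *\<^sub>R b i) \<le> (\<Sum>i\<in>UNIV. c i * breg a (b i))"
    and iter: "dscmd_n M X chi Phi dPhi P al r xi G x0 x y"
    and hist: "history M Fil X xi G x y"
    and net: "network_assumption P B theta"
    and sub: "subgradient_assumption M Fil X f g Gf xi G y"
    and noise: "noise_assumption M Fil xi nu"
    and al: "\<And>t. al t = 1 / sqrt (real t + 1)"
    and r: "\<And>t. r t = 1 / (real t + 1)"
begin

abbreviation "H \<equiv> max_subgradient_norm X chi"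
abbreviation "gt t i w \<equiv> G t i (y t i w) w"
abbreviation "S t \<equiv> join_noise M (Fil (int t - 1)) (xi t)"
text \<open>The conditional expectation itself rather than \<open>g i (y t i w)\<close>: it is
  measurable by construction, matches \<open>cond_exp_orthogonal\<close>, and is almost everywhere a
  subgradient.\<close>

abbreviation "m t i w \<equiv> vec_cond_exp M (S t) (gt t i) w"

lemma Gf_nonneg: "Gf \<ge> 0" and nu_nonneg: "nu \<ge> 0"
  using sub noise by (auto simp: subgradient_assumption_def noise_assumption_def)

lemma Fil_sub: "subalgebra M (Fil t)"
  using hist by (simp add: history_def)

lemma Fil_measurable: "Z \<in> borel_measurable (Fil t) \<Longrightarrow> Z \<in> borel_measurable M"
  using measurable_from_subalg[OF Fil_sub] by blast

lemma xi_measurable: "xi t i j \<in> borel_measurable M" and gt_measurable: "gt t i \<in> borel_measurable M"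
  and y_measurable: "y t i \<in> borel_measurable M"
  using hist Fil_measurable unfolding history_def by blast+

lemma x_measurable_Fil: "x t i \<in> borel_measurable (Fil (int t - 1))"
proof (cases t)
  case 0
  have "x 0 i w = x0 i" if "w \<in> space (Fil (-1))" for w
    using iter that Fil_sub[of "-1"] by (simp add: dscmd_n_def subalgebra_def)
  then have "x 0 i \<in> borel_measurable (Fil (-1)) \<longleftrightarrow> (\<lambda>_. x0 i) \<in> borel_measurable (Fil (-1))"
    by (rule measurable_cong)
  then show ?thesis using 0 by simp
next
  case (Suc s)
  then show ?thesis using hist by (simp add: history_def)
qed

lemma x_measurable: "x t i \<in> borel_measurable M"
  by (rule Fil_measurable[OF x_measurable_Fil])

lemma S_sub: "subalgebra M (S t)"
  by (rule subalgebra_join_noise(1)[OF Fil_sub xi_measurable])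

lemma y_eq: "w \<in> space M \<Longrightarrow> y t i w = (\<Sum>j\<in>UNIV. P t $ i $ j *\<^sub>R (x t j w + r t *\<^sub>R xi t i j w))"
  using iter by (simp add: dscmd_n_def)

text \<open>The query point is a function of the past and of the noises of time \<open>t\<close>,
  which is what \<open>S t\<close> records. Conditioning on \<open>S t\<close> therefore leaves it
  fixed.\<close>

lemma y_measurable_S: "y t i \<in> borel_measurable (S t)"
proof -
  note jn = subalgebra_join_noise[where xi = "xi t", OF Fil_sub[of "int t - 1"] xi_measurable]
  have "subalgebra (S t) (Fil (int t - 1))"
    using jn(2,3) Fil_sub[of "int t - 1"] by (simp add: subalgebra_def)
  then have [measurable]: "x t j \<in> borel_measurable (S t)" for j
    using x_measurable_Fil measurable_from_subalg by blast
  note jn(4)[measurable]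
  have "y t i \<in> borel_measurable (S t) \<longleftrightarrow>
      (\<lambda>w. \<Sum>j\<in>UNIV. P t $ i $ j *\<^sub>R (x t j w + r t *\<^sub>R xi t i j w)) \<in> borel_measurable (S t)"
    by (rule measurable_cong) (simp add: jn(3) y_eq)
  then show ?thesis by simp
qed

lemma xi_moments: "mean_le M (\<lambda>w. (norm (xi t i j w))\<^sup>2) nu" "mean_le M (\<lambda>w. norm (xi t i j w)) (sqrt nu)"
proof -
  have "AE w in M. nn_cond_exp M (Fil (int t - 1)) (\<lambda>w. ennreal ((norm (xi t i j w))\<^sup>2)) w \<le> ennreal nu"
    using noise unfolding noise_assumption_def by blast
  note cond_second_moment[OF Fil_sub xi_measurable nu_nonneg this]
  then show "mean_le M (\<lambda>w. (norm (xi t i j w))\<^sup>2) nu" "mean_le M (\<lambda>w. norm (xi t i j w)) (sqrt nu)" by auto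
qed

lemma gt_moments: "mean_le M (\<lambda>w. (norm (gt t i w))\<^sup>2) (Gf\<^sup>2)" "mean_le M (\<lambda>w. norm (gt t i w)) Gf"
proof -
  have "AE w in M. nn_cond_exp M (S t) (\<lambda>w. ennreal ((norm (gt t i w))\<^sup>2)) w \<le> ennreal (Gf\<^sup>2)"
    using sub unfolding subgradient_assumption_def cond_moments_def by blast
  note cond_second_moment[OF S_sub gt_measurable zero_le_power2 this]
  then show "mean_le M (\<lambda>w. (norm (gt t i w))\<^sup>2) (Gf\<^sup>2)" "mean_le M (\<lambda>w. norm (gt t i w)) Gf"
    using Gf_nonneg by auto
qed

lemma m_subgradient: "AE w in M. m t i w \<in> subdifferential (f i) (y t i w)"
proof -
  have "AE w in M. g i (y t i w) \<in> subdifferential (f i) (y t i w)"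
    "AE w in M. m t i w = g i (y t i w)"
    using sub unfolding subgradient_assumption_def cond_moments_def by blast+
  then show ?thesis by eventually_elim simp
qed

lemma g_subgradient: "z \<in> X \<Longrightarrow> g i z \<in> subdifferential (f i) z"
  using sub unfolding subgradient_assumption_def by blast

text \<open>\<open>g i z\<close> is the mean of a random vector whose second moment is at most
  \<open>Gf\<^sup>2\<close>. Pairing that vector with \<open>g i z\<close> gives
  \<open>(norm (g i z))\<^sup>2 \<le> norm (g i z) * Gf\<close>; time 0 supplies the random
  vector.\<close>

lemma g_norm:
  assumes z: "z \<in> X"
  shows "norm (g i z) \<le> Gf"
proof -
  let ?S = "Fil (int 0 - 1)" and ?Z = "G 0 i z"
  interpret sigma_finite_subalgebra M ?S by (rule subalgebra_sigma_finite[OF Fil_sub])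
  have Z: "?Z \<in> borel_measurable M" using hist Fil_measurable z unfolding history_def by blast
  have cm: "cond_moments M ?S ?Z (\<lambda>w. g i z) (Gf\<^sup>2)"
    using sub z unfolding subgradient_assumption_def by blast
  then have "AE w in M. nn_cond_exp M ?S (\<lambda>w. ennreal ((norm (?Z w))\<^sup>2)) w \<le> ennreal (Gf\<^sup>2)"
    by (simp add: cond_moments_def)
  note mom = cond_second_moment[OF Fil_sub Z zero_le_power2 this]
  have int: "integrable M (\<lambda>w. ?Z w $ k)" for k
    using integrable_inner_left[OF mom(3), of "axis k 1"] by (simp add: inner_axis)
  have "expectation (\<lambda>w. ?Z w $ k) = g i z $ k" for k
  proof -
    have "expectation (\<lambda>w. ?Z w $ k) = expectation (real_cond_exp M ?S (\<lambda>w. ?Z w $ k))"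
      using real_cond_exp_int(2)[OF int[of k]] by simp
    also have "\<dots> = expectation (\<lambda>w. g i z $ k)"
    proof (rule integral_cong_AE)
      show "AE w in M. real_cond_exp M ?S (\<lambda>w. ?Z w $ k) w = g i z $ k"
        using cm unfolding cond_moments_def by (auto simp: vec_cond_exp_def vec_eq_iff)
    qed auto
    finally show ?thesis by (simp add: prob_space)
  qed
  then have "expectation (\<lambda>w. inner (g i z) (?Z w)) = inner (g i z) (g i z)"
    using int by (simp add: inner_vec_def)
  moreover have "expectation (\<lambda>w. inner (g i z) (?Z w)) \<le> norm (g i z) * Gf"
  proof (rule mean_leD)
    show "mean_le M (\<lambda>w. norm (g i z) * norm (?Z w)) (norm (g i z) * Gf)"
      using mean_le_cmult[OF mom(2), of "norm (g i z)"] Gf_nonneg by simp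
    show "integrable M (\<lambda>w. inner (g i z) (?Z w))" using mom(3) by (rule integrable_inner_right)
  qed (auto intro: norm_cauchy_schwarz)
  ultimately have "norm (g i z) * norm (g i z) \<le> norm (g i z) * Gf"
    by (simp add: power2_norm_eq_inner[symmetric] power2_eq_square)
  then show ?thesis using Gf_nonneg by (cases "norm (g i z) = 0") (auto simp: mult_le_cancel_left)
qed

lemma H_nonneg: "H \<ge> 0"
proof -
  have "x0 i \<in> X" for i using iter by (simp add: dscmd_n_def)
  then show ?thesis using max_subgradient_norm_nonneg[where chi = chi, OF chi X(2)] by blast
qed

text \<open>For each \<open>t\<close> and \<open>i\<close> the subgradient property fails on a null
  set; there are countably many pairs, so one null set serves the whole trajectory.\<close>

lemma path:
  "AE w in M. dscmd_path X Phi dPhi sigma L D d f chi P B theta al r (\<lambda>t i. x t i w) (\<lambda>t i. y t i w)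
     (\<lambda>t i. gt t i w) (\<lambda>t i. m t i w) (\<lambda>t i j. xi t i j w) g Gf H"
proof -
  have "AE w in M. \<forall>t i. m t i w \<in> subdifferential (f i) (y t i w)"
    by (simp add: AE_all_countable m_subgradient)
  then show ?thesis
  proof (rule AE_mp, intro AE_I2 impI)
    fix w assume w: "w \<in> space M" and ms: "\<forall>t i. m t i w \<in> subdifferential (f i) (y t i w)"
    have arg: "is_arg_min (\<lambda>z. inner (gt t i w) z + 1 / al t * breg z (y t i w) + chi i z)
       (\<lambda>z. z \<in> X) (x (Suc t) i w)" for t i using iter w unfolding dscmd_n_def by blast
    show "dscmd_path X Phi dPhi sigma L D d f chi P B theta al r (\<lambda>t i. x t i w) (\<lambda>t i. y t i w)
     (\<lambda>t i. gt t i w) (\<lambda>t i. m t i w) (\<lambda>t i j. xi t i j w) g Gf H"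
    proof (unfold_locales)
      show "x 0 i w \<in> X" for i using iter w by (simp add: dscmd_n_def)
      show "chi i a - chi i b \<le> H * norm (a - b)" if "a \<in> X" for i a b
        by (rule diff_le_max_subgradient_norm[OF chi X(2) that])
      show "is_arg_min (\<lambda>z. inner (gt t i w) z + 1 / al t * breg z (y t i w) + chi i z)
        (\<lambda>z. z \<in> X) (x (Suc t) i w)" for t i by (rule arg)
      show "y t i w = (\<Sum>j\<in>UNIV. P t $ i $ j *\<^sub>R (x t j w + r t *\<^sub>R xi t i j w))" for t i
        by (rule y_eq[OF w])
    qed (use ms w in \<open>auto simp: chi breg_convex net al r g_subgradient g_norm H_nonneg\<close>)
  qed
qed

lemma x_in: "w \<in> space M \<Longrightarrow> x t i w \<in> X"
  using iter by (cases t) (auto simp: dscmd_n_def is_arg_min_def)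

definition noise_mean :: "nat \<Rightarrow> real" where
  "noise_mean t = real CARD('v) * (L * (r t)\<^sup>2 * nu + L * d * r t * sqrt nu)"

lemma P_row: "(\<Sum>j\<in>UNIV. P t $ i $ j) = 1" and P_nonneg: "P t $ i $ j \<ge> 0"
  using net by (auto simp: network_assumption_def doubly_stochastic_def)

lemma r_nonneg: "r t \<ge> 0" by (simp add: r)
lemma al_nonneg: "al t \<ge> 0" by (simp add: al)

lemma integrable_bounded_on:
  fixes h :: "'w \<Rightarrow> real"
  assumes "h \<in> borel_measurable M" "\<And>w. w \<in> space M \<Longrightarrow> \<bar>h w\<bar> \<le> b"
  shows "integrable M h"
  by (rule integrable_const_bound[where B = b]) (use assms in auto)

text \<open>The vector \<open>y t i w - xs\<close> is known given \<open>S t\<close> and square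
  integrable: it averages points within \<open>d\<close> of the origin, shifted by noises of finite
  second moment.\<close>

lemma mean_correlation:
  assumes "xs \<in> X"
  shows "mean_le M (\<lambda>w. inner (m t i w - gt t i w) (y t i w - xs)) 0"
proof (rule cond_exp_orthogonal[OF S_sub gt_measurable])
  show "integrable M (\<lambda>w. (norm (gt t i w))\<^sup>2)" using gt_moments(1) by (simp add: mean_le_def)
  show "(\<lambda>w. y t i w - xs) \<in> borel_measurable (S t)" using y_measurable_S by simp
  have nn: "norm (y t i w - xs) \<le> d + r t * (\<Sum>j\<in>UNIV. norm (xi t i j w))" if w: "w \<in> space M" for w
  proof -
    have "y t i w - xs = (\<Sum>j\<in>UNIV. P t $ i $ j *\<^sub>R ((x t j w - xs) + r t *\<^sub>R xi t i j w))"
      using w by (simp add: y_eq scaleR_add_right scaleR_diff_right sum.distrib sum_subtractf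
          scaleR_sum_left[symmetric] P_row)
    also have "norm \<dots> \<le> (\<Sum>j\<in>UNIV. P t $ i $ j * (d + r t * norm (xi t i j w)))"
    proof (rule sum_norm_le)
      fix j
      have "norm ((x t j w - xs) + r t *\<^sub>R xi t i j w) \<le> d + r t * norm (xi t i j w)"
        using norm_triangle_ineq[of "x t j w - xs" "r t *\<^sub>R xi t i j w"] norm_le_d[OF x_in[OF w] assms, of t j] r_nonneg[of t]
        by simp
      then show "norm (P t $ i $ j *\<^sub>R ((x t j w - xs) + r t *\<^sub>R xi t i j w)) \<le> P t $ i $ j * (d + r t * norm (xi t i j w))"
        using P_nonneg[of t i j] by (simp add: mult_left_mono)
    qed
    also have "\<dots> = d + (\<Sum>j\<in>UNIV. P t $ i $ j * (r t * norm (xi t i j w)))"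
      by (simp add: distrib_left sum.distrib sum_distrib_right[symmetric] P_row)
    also have "(\<Sum>j\<in>UNIV. P t $ i $ j * (r t * norm (xi t i j w))) \<le> (\<Sum>j\<in>UNIV. 1 * (r t * norm (xi t i j w)))"
    proof (intro sum_mono mult_right_mono)
      fix j show "P t $ i $ j \<le> 1"
        unfolding P_row[of t i, symmetric] by (rule member_le_sum) (auto simp: P_nonneg)
    qed (use r_nonneg in auto)
    finally show ?thesis by (simp add: sum_distrib_left)
  qed
  have sq: "norm ((norm (y t i w - xs))\<^sup>2)
      \<le> norm (2 * d\<^sup>2 + 2 * ((r t)\<^sup>2 * (real CARD('v) * (\<Sum>j\<in>UNIV. (norm (xi t i j w))\<^sup>2))))" if "w \<in> space M" for w
  proof -
    let ?s = "\<Sum>j\<in>UNIV. norm (xi t i j w)"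
    have "(norm (y t i w - xs))\<^sup>2 \<le> (d + r t * ?s)\<^sup>2" using nn[OF that] by (intro power_mono) auto
    also have "\<dots> \<le> 2 * d\<^sup>2 + 2 * ((r t)\<^sup>2 * ?s\<^sup>2)"
      using zero_le_power2[of "d - r t * ?s"] by (simp add: power2_eq_square algebra_simps)
    also have "?s\<^sup>2 \<le> real CARD('v) * (\<Sum>j\<in>UNIV. (norm (xi t i j w))\<^sup>2)"
      using sum_squared_le_sum_of_squares[of "\<lambda>j. norm (xi t i j w)" "UNIV :: 'v set"] by (simp add: mult.commute)
    finally show ?thesis by (simp add: mult_left_mono)
  qed
  show "integrable M (\<lambda>w. (norm (y t i w - xs))\<^sup>2)"
  proof (rule Bochner_Integration.integrable_bound)
    show "integrable M (\<lambda>w. 2 * d\<^sup>2 + 2 * ((r t)\<^sup>2 * (real CARD('v) * (\<Sum>j\<in>UNIV. (norm (xi t i j w))\<^sup>2))))"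
      using xi_moments(1) by (simp add: mean_le_def)
    show "(\<lambda>w. (norm (y t i w - xs))\<^sup>2) \<in> borel_measurable M" using y_measurable by measurable
  qed (use sq in auto)
qed

text \<open>The disagreement bound \<open>K\<close> is left open, so that the phases can be chosen
  separately.\<close>

lemma expected_regret:
  assumes xs: "xs \<in> X" and T: "T \<ge> 1"
    and K: "mean_le M (\<lambda>w. \<Sum>t=1..T. \<Sum>i\<in>UNIV. norm (x t l w - x t i w)) K"
  shows "real T * (expectation (\<lambda>w. \<Sum>i\<in>UNIV. f i ((1 / real T) *\<^sub>R (\<Sum>t = 1..T. x t l w))
             + chi i ((1 / real T) *\<^sub>R (\<Sum>t = 1..T. x t l w))) - (\<Sum>i\<in>UNIV. f i xs + chi i xs))
    \<le> (\<Sum>t<T. real CARD('v) * (al t * (2 * Gf\<^sup>2) / sigma) + 1 / al t * noise_mean t)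
      + sqrt (real T) * (real CARD('v) * D\<^sup>2) + (Gf + H) * K"
proof -
  define F where "F z = (\<Sum>i\<in>UNIV. f i z + chi i z)" for z
  define xb where "xb w = (1 / real T) *\<^sub>R (\<Sum>t = 1..T. x t l w)" for w
  have Fc: "convex_on UNIV F" unfolding F_def by (intro convex_on_sum_fun convex_on_add f chi) simp
  have Fcont: "continuous_on UNIV F" by (rule convex_on_continuous[OF open_UNIV Fc])
  have [measurable]: "F \<in> borel_measurable borel" using Fcont by (rule borel_measurable_continuous_onI)
  have [measurable]: "xb \<in> borel_measurable M" unfolding xb_def using x_measurable by measurable
  have xb: "xb w \<in> X" if "w \<in> space M" for w
    unfolding xb_def scaleR_sum_right by (rule convex_sum) (use T X x_in[OF that] in auto)
  \<comment> \<open>\<open>F\<close> is bounded on the compact \<open>X\<close>, which contains all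
    averages; this makes the expectation in the claim a genuine integral.\<close>
  have "compact (F ` X)" using X Fcont by (meson compact_continuous_image continuous_on_subset subset_UNIV)
  then obtain b where b: "\<And>z. z \<in> X \<Longrightarrow> \<bar>F z\<bar> \<le> b"
    using compact_imp_bounded by (fastforce simp: bounded_iff)
  have intF: "integrable M (\<lambda>w. F (xb w))"
    by (rule integrable_bounded_on[where b = b]) (use b xb in auto)
  let ?rhs = "\<lambda>w. (\<Sum>t<T. (\<Sum>i\<in>UNIV. inner (m t i w - gt t i w) (y t i w - xs) + al t * ((norm (gt t i w))\<^sup>2 + Gf\<^sup>2) / sigma)
          + 1 / al t * (\<Sum>i\<in>UNIV. \<Sum>j\<in>UNIV. P t $ i $ j *
      (L * (r t)\<^sup>2 * (norm (xi t i j w))\<^sup>2 + L * d * r t * norm (xi t i j w))))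
      + sqrt (real T) * (real CARD('v) * D\<^sup>2)
      + (Gf + H) * (\<Sum>t=1..T. \<Sum>i\<in>UNIV. norm (x t l w - x t i w))"
  have "AE w in M. real T * (F (xb w) - F xs) \<le> ?rhs w"
    using path
  proof eventually_elim
    fix w assume "dscmd_path X Phi dPhi sigma L D d f chi P B theta al r (\<lambda>t i. x t i w) (\<lambda>t i. y t i w)
     (\<lambda>t i. gt t i w) (\<lambda>t i. m t i w) (\<lambda>t i j. xi t i j w) g Gf H"
    then interpret p: dscmd_path X Phi dPhi sigma L D d f chi P B theta al r "\<lambda>t i. x t i w" "\<lambda>t i. y t i w"
     "\<lambda>t i. gt t i w" "\<lambda>t i. m t i w" "\<lambda>t i j. xi t i j w" g Gf H .
    have "F (xb w) \<le> (\<Sum>t=1..T. (1 / real T) * F (x t l w))"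
      unfolding xb_def scaleR_sum_right by (rule convex_on_sum[OF _ _ Fc]) (use T in auto)
    also have "\<dots> = (\<Sum>t=1..T. F (x t l w)) / real T" by (simp add: sum_divide_distrib)
    finally have "real T * (F (xb w) - F xs) \<le> (\<Sum>t=1..T. F (x t l w) - F xs)"
      using T by (simp add: field_simps sum_subtractf)
    also have "\<dots> \<le> ?rhs w"
      using p.regret[OF xs, of l T] by (simp only: F_def p.noise_cost_def)
    finally show "real T * (F (xb w) - F xs) \<le> ?rhs w" .
  qed
  moreover have "mean_le M ?rhs ((\<Sum>t<T. (\<Sum>i\<in>(UNIV :: 'v set). 0 + al t * (Gf\<^sup>2 + Gf\<^sup>2) / sigma)
          + 1 / al t * (\<Sum>i\<in>UNIV. \<Sum>j\<in>UNIV. P t $ i $ j *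
      (L * (r t)\<^sup>2 * nu + L * d * r t * sqrt nu)))
      + sqrt (real T) * (real CARD('v) * D\<^sup>2) + (Gf + H) * K)"
    by (intro mean_le_add mean_le_sum mean_le_cmult mean_le_divide mean_le_const
        mean_correlation[OF xs] gt_moments xi_moments K)
      (use sigma L_nonneg d_nonneg r_nonneg al_nonneg Gf_nonneg H_nonneg P_nonneg in \<open>auto simp: sum_nonneg\<close>)
  moreover have "integrable M (\<lambda>w. real T * (F (xb w) - F xs))" using intF by simp
  ultimately have "expectation (\<lambda>w. real T * (F (xb w) - F xs)) \<le> (\<Sum>t<T. (\<Sum>i\<in>(UNIV :: 'v set). 0 + al t * (Gf\<^sup>2 + Gf\<^sup>2) / sigma)
          + 1 / al t * (\<Sum>i\<in>UNIV. \<Sum>j\<in>UNIV. P t $ i $ j *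
      (L * (r t)\<^sup>2 * nu + L * d * r t * sqrt nu)))
      + sqrt (real T) * (real CARD('v) * D\<^sup>2) + (Gf + H) * K"
    by (intro mean_leD)
  also have "expectation (\<lambda>w. real T * (F (xb w) - F xs)) = real T * (expectation (\<lambda>w. F (xb w)) - F xs)"
    using intF by (simp add: prob_space)
  finally show ?thesis
    by (simp only: F_def xb_def sum_distrib_right[symmetric] P_row noise_mean_def) simp
qed

lemma spread_integrable: "integrable M (\<lambda>w. \<Sum>t\<in>A. \<Sum>i\<in>UNIV. norm (x t l w - x t i w))"
proof (intro Bochner_Integration.integrable_sum)
  fix t i
  show "integrable M (\<lambda>w. norm (x t l w - x t i w))"
    by (rule integrable_bounded_on[where b = d]) (use x_measurable norm_le_d x_in in auto)
qed

lemma expected_spread_trivial: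
  assumes "finite A"
  shows "mean_le M (\<lambda>w. \<Sum>t\<in>A. \<Sum>i\<in>UNIV. norm (x t l w - x t i w)) (real (card A) * (real CARD('v) * d))"
  unfolding mean_le_def
proof
  show "expectation (\<lambda>w. \<Sum>t\<in>A. \<Sum>i\<in>UNIV. norm (x t l w - x t i w)) \<le> real (card A) * (real CARD('v) * d)"
  proof (rule mean_leD[OF mean_le_const _ spread_integrable], rule AE_I2)
    fix w assume "w \<in> space M"
    then have "(\<Sum>t\<in>A. \<Sum>i\<in>UNIV. norm (x t l w - x t i w)) \<le> (\<Sum>t\<in>A. \<Sum>i\<in>(UNIV::'v set). d)"
      by (intro sum_mono norm_le_d x_in)
    then show "(\<Sum>t\<in>A. \<Sum>i\<in>UNIV. norm (x t l w - x t i w)) \<le> real (card A) * (real CARD('v) * d)" by simp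
  qed
qed (rule spread_integrable)

lemma expected_spread_restart:
  assumes N: "CARD('v) \<ge> 2" and s: "s < T"
  shows "mean_le M (\<lambda>w. \<Sum>t=Suc s..T. \<Sum>i\<in>UNIV. norm (x t l w - x t i w))
    (2 * real CARD('v) * (real B * (1 + real CARD('v) ^ 3 / (2 * theta))) * (real CARD('v) * d
       + (\<Sum>t=s..<T. real CARD('v) * (2 * al t * (Gf + H) / sigma + sqrt (2 * L / sigma) * (r t * sqrt nu)))))"
    (is "mean_le M ?Z (2 * ?N * ?lam * _)")
  unfolding mean_le_def
proof
  have lam: "?lam \<ge> 0" using net by (simp add: network_assumption_def)
  show "expectation ?Z \<le> 2 * ?N * ?lam * (?N * d
       + (\<Sum>t=s..<T. ?N * (2 * al t * (Gf + H) / sigma + sqrt (2 * L / sigma) * (r t * sqrt nu))))"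
  proof (rule mean_leD[OF _ _ spread_integrable])
    have "mean_le M (\<lambda>w. 2 * ?N * ?lam * (?N * d
       + (\<Sum>t=s..<T. \<Sum>i\<in>UNIV. 2 * al t * (norm (gt t i w) + H) / sigma
            + sqrt (2 * L / sigma) * (r t * (\<Sum>j\<in>UNIV. P t $ i $ j * norm (xi t i j w))))))
      (2 * ?N * ?lam * (?N * d
       + (\<Sum>t=s..<T. \<Sum>i\<in>(UNIV::'v set). 2 * al t * (Gf + H) / sigma
            + sqrt (2 * L / sigma) * (r t * (\<Sum>j\<in>UNIV. P t $ i $ j * sqrt nu)))))"
      by (intro mean_le_add mean_le_sum mean_le_cmult mean_le_divide mean_le_const gt_moments xi_moments)
        (use sigma L_nonneg d_nonneg r_nonneg al_nonneg P_nonneg lam in auto)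
    then show "mean_le M (\<lambda>w. 2 * ?N * ?lam * (?N * d
       + (\<Sum>t=s..<T. \<Sum>i\<in>UNIV. 2 * al t * (norm (gt t i w) + H) / sigma
            + sqrt (2 * L / sigma) * (r t * (\<Sum>j\<in>UNIV. P t $ i $ j * norm (xi t i j w))))))
      (2 * ?N * ?lam * (?N * d
       + (\<Sum>t=s..<T. ?N * (2 * al t * (Gf + H) / sigma + sqrt (2 * L / sigma) * (r t * sqrt nu)))))"
      by (simp add: sum_distrib_right[symmetric] P_row)
    show "AE w in M. ?Z w \<le> 2 * ?N * ?lam * (?N * d
       + (\<Sum>t=s..<T. \<Sum>i\<in>UNIV. 2 * al t * (norm (gt t i w) + H) / sigma
            + sqrt (2 * L / sigma) * (r t * (\<Sum>j\<in>UNIV. P t $ i $ j * norm (xi t i j w)))))"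
      using path
    proof eventually_elim
      case (elim w)
      then interpret p: dscmd_path X Phi dPhi sigma L D d f chi P B theta al r "\<lambda>t i. x t i w" "\<lambda>t i. y t i w"
       "\<lambda>t i. gt t i w" "\<lambda>t i. m t i w" "\<lambda>t i j. xi t i j w" g Gf H .
      show ?case by (rule p.consensus[OF N s])
    qed
  qed
qed (rule spread_integrable)

end

section \<open>Summing the rates\<close>

text \<open>Bernoulli applied to \<open>(1 / gamma) ^ B = 1 / beta\<close> gives
  \<open>B * (1 - gamma) \<le> (1 - beta) / beta\<close>. One factor \<open>1 / beta\<close> of
  \<open>omega\<close> cancels this \<open>beta\<close>, and the other is at least 1.\<close>

lemma geometric_constant_ge:
  fixes theta N omega gamma beta :: real
  assumes th: "0 < theta" "theta < 1" and N: "N \<ge> 1" and B: "B \<ge> 1"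
    and beta: "beta = 1 - theta / (4 * N\<^sup>2)"
    and omega: "omega = beta powi (- 2)" and gamma: "gamma = beta powr (1 / real B)"
  shows "0 < omega / (1 - gamma)" "4 * N\<^sup>2 * real B / theta \<le> omega / (1 - gamma)"
proof -
  have N2: "N\<^sup>2 \<ge> 1" using N by (simp add: one_le_power)
  then have "theta < 4 * N\<^sup>2" "0 < 4 * N\<^sup>2" using th by linarith+
  then have b: "0 < beta" "beta < 1" using th by (simp_all add: beta)
  have om: "omega = 1 / beta\<^sup>2" using b by (simp add: omega power_int_minus divide_inverse)
  have g: "0 < gamma" "gamma < 1" using b B powr_less_mono2[of "1 / real B" beta 1] by (auto simp: gamma)
  have gB: "gamma ^ B = beta"
    using b B g by (simp add: gamma powr_realpow[symmetric] powr_powr)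
  have "1 + real B * (1 / gamma - 1) \<le> (1 + (1 / gamma - 1)) ^ B"
    using g by (intro Bernoulli_inequality) (simp add: field_simps)
  also have "\<dots> = 1 / beta" by (simp add: power_divide gB)
  finally have "real B * (1 / gamma - 1) \<le> 1 / beta - 1" by simp
  moreover have "real B * (1 - gamma) \<le> real B * (1 / gamma - 1)"
  proof (rule mult_left_mono)
    have "gamma * (1 - gamma) \<le> 1 * (1 - gamma)" using g by (intro mult_right_mono) auto
    then show "1 - gamma \<le> 1 / gamma - 1" using g by (simp add: field_simps)
  qed simp
  ultimately have "real B * (1 - gamma) \<le> (1 - beta) / beta" using b by (simp add: diff_divide_distrib)
  then have 1: "real B / (1 - beta) \<le> (1 / beta) / (1 - gamma)"
    using b g by (simp add: field_simps)
  also have "(1 / beta) / (1 - gamma) \<le> omega / (1 - gamma)"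
  proof (rule divide_right_mono)
    have "beta * beta \<le> beta * 1" using b by (intro mult_left_mono) auto
    then show "1 / beta \<le> omega" unfolding om using b by (intro divide_left_mono) (auto simp: power2_eq_square)
  qed (use g in simp)
  finally show "4 * N\<^sup>2 * real B / theta \<le> omega / (1 - gamma)" by (simp add: beta field_simps)
  show "0 < omega / (1 - gamma)" using b g by (simp add: om)
qed

lemma sum_inverse_sqrt_le: "(\<Sum>t<T. 1 / sqrt (real t + 1)) \<le> 2 * sqrt (real T)"
proof (induction T)
  case (Suc T)
  define u where "u = sqrt (real T)"
  define v where "v = sqrt (real T + 1)"
  have uv: "u \<le> v" "u\<^sup>2 = real T" "v\<^sup>2 = real T + 1" "v > 0" "u \<ge> 0" by (auto simp: u_def v_def)
  have "1 = (v - u) * (v + u)" using uv by (simp add: power2_eq_square algebra_simps)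
  also have "\<dots> \<le> (v - u) * (2 * v)" using uv by (intro mult_left_mono) auto
  finally have "1 / v \<le> 2 * (v - u)" using uv by (simp add: field_simps)
  then show ?case using Suc by (simp add: u_def v_def add.commute)
qed simp

text \<open>Comparison with the differences of \<open>- 2 / sqrt t\<close>. The induction needs the
  sharper bound \<open>3 - 2 / sqrt T\<close>, an equality at \<open>T = 1\<close>.\<close>

lemma sum_three_halves_le:
  assumes "T \<ge> 1"
  shows "(\<Sum>t<T. sqrt (real t + 1) / (real t + 1)\<^sup>2) \<le> 3"
proof -
  have "(\<Sum>t<T. sqrt (real t + 1) / (real t + 1)\<^sup>2) \<le> 3 - 2 / sqrt (real T)"
    using assms
  proof (induction T rule: nat_induct_at_least)
    case (Suc T)
    define u where "u = sqrt (real T)"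
    define v where "v = sqrt (real T + 1)"
    have uv: "u \<le> v" "u\<^sup>2 = real T" "v\<^sup>2 = real T + 1" "v > 0" "u > 0" using Suc by (auto simp: u_def v_def)
    have one: "1 = (v - u) * (v + u)" using uv by (simp add: power2_eq_square algebra_simps)
    have "u * (v + u) \<le> v * (v + v)" using uv by (intro mult_mono) auto
    then have "(v - u) * (u * (v + u)) \<le> (v - u) * (v * (v + v))" using uv by (intro mult_left_mono) auto
    moreover have "(v - u) * (u * (v + u)) = u" using one by (metis mult.left_commute mult.right_neutral)
    ultimately have "u \<le> 2 * (v - u) * v\<^sup>2" by (simp add: power2_eq_square algebra_simps)
    then have "u / (u * v * v\<^sup>2) \<le> 2 * (v - u) * v\<^sup>2 / (u * v * v\<^sup>2)"
      using uv(4,5) by (intro divide_right_mono) auto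
    moreover have "u / (u * v * v\<^sup>2) = v / (v\<^sup>2)\<^sup>2" using uv(4,5) by (simp add: power2_eq_square)
    moreover have "2 * (v - u) * v\<^sup>2 / (u * v * v\<^sup>2) = 2 / u - 2 / v"
      using uv(4,5) by (simp add: diff_divide_distrib right_diff_distrib)
    ultimately have "v / (v\<^sup>2)\<^sup>2 \<le> 2 / u - 2 / v" by simp
    moreover have "v = sqrt (1 + real T)" by (simp add: v_def add.commute)
    ultimately show ?case using Suc uv(3) unfolding u_def[symmetric] by (simp add: add.commute)
  qed simp
  then show ?thesis by (smt (verit) divide_nonneg_nonneg of_nat_0_le_iff real_sqrt_ge_zero)
qed

text \<open>The largest term times \<open>T\<close>: crude, but it avoids a logarithm.\<close>

lemma sum_inverse_tail_le: "(\<Sum>t=s..<T. 1 / (real t + 1)) \<le> real T / (real s + 1)"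
proof -
  have "(\<Sum>t=s..<T. 1 / (real t + 1)) \<le> (\<Sum>t=s..<T. 1 / (real s + 1))"
    by (intro sum_mono divide_left_mono) auto
  also have "\<dots> \<le> real T / (real s + 1)" by (simp add: divide_right_mono)
  finally show ?thesis .
qed

lemma sum_inverse_sqrt_tail_le: "(\<Sum>t=s..<T. 1 / sqrt (real t + 1)) \<le> 2 * sqrt (real T)"
proof -
  have "(\<Sum>t=s..<T. 1 / sqrt (real t + 1)) \<le> (\<Sum>t<T. 1 / sqrt (real t + 1))"
    by (intro sum_mono2) auto
  with sum_inverse_sqrt_le[of T] show ?thesis by linarith
qed

section \<open>Distributing the disagreement cost over the rate constants\<close>

lemma trivial_phase_budget:
  fixes N d K G a k sigma :: real
  assumes "N \<ge> 0" "a \<ge> 0" "G \<ge> 0" "d \<ge> 0" "sigma > 0" and ak: "a \<le> k"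
  shows "G * (a\<^sup>2 * (N * d)) \<le> a * (N * (sigma * d\<^sup>2 / 5 + 5 / 4 * (k\<^sup>2 * G\<^sup>2 / sigma)))"
proof -
  \<comment> \<open>The parameter \<open>sigma / 5\<close> makes the first summand two fifths of
    \<open>D\<^sup>2 = sigma * d\<^sup>2 / 2\<close>, the share left free by the coefficient of
    C2.\<close>
  have "d * (k * G) \<le> sigma / 5 * d\<^sup>2 + (k * G)\<^sup>2 / (4 * (sigma / 5))"
    using assms by (intro AM_GM_scaled) simp
  also have "\<dots> = sigma * d\<^sup>2 / 5 + 5 / 4 * (k\<^sup>2 * G\<^sup>2 / sigma)" by (simp add: power_mult_distrib)
  finally have 1: "d * (k * G) \<le> \<dots>" .
  have "G * (a\<^sup>2 * (N * d)) = a * (N * (d * G)) * a" by (simp add: power2_eq_square)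
  also have "\<dots> \<le> a * (N * (d * G)) * k" using assms by (intro mult_left_mono) auto
  also have "\<dots> = a * (N * (d * (k * G)))" by simp
  also have "\<dots> \<le> a * (N * (sigma * d\<^sup>2 / 5 + 5 / 4 * (k\<^sup>2 * G\<^sup>2 / sigma)))"
    using 1 assms by (intro mult_left_mono) auto
  finally show ?thesis .
qed

text \<open>To be read with \<open>a = sqrt T\<close>, \<open>k = sqrt R\<close> and
  \<open>s\<close> the integer part of \<open>k * a\<close>. The diameter terms carry
  \<open>1 + 5 / 16 = 21 / 16\<close>. The diameter, subgradient and noise parts contribute
  \<open>2205 / 1024\<close>, \<open>5 / 4\<close> and \<open>5 / 64\<close> to the coefficient of
  \<open>k\<^sup>2 * G\<^sup>2 / sigma\<close>, together below \<open>7 / 2\<close>.\<close>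

lemma restart_phase_budget:
  fixes N d G a k sigma s lam q Lnu :: real
  assumes nn: "N \<ge> 0" "G \<ge> 0" "d \<ge> 0" "sigma > 0" and k: "0 < k" "k < a"
    and s: "s \<le> k * a" "k * a \<le> s + 1"
    and lam: "0 \<le> lam" "lam \<le> 5 / 16 * k\<^sup>2" and q: "q \<ge> 0" "q\<^sup>2 = 2 * Lnu / sigma"
  shows "G * (s * (N * d) + lam * (N * d + N * (4 * a * G / sigma + q * (a\<^sup>2 / (s + 1)))))
    \<le> a * (N * (sigma * d\<^sup>2 / 5 + 7 / 2 * (k\<^sup>2 * G\<^sup>2 / sigma) + 6 / 5 * Lnu))"
proof -
  have a: "a > 0" using k by simp
  have "lam \<le> 5 / 16 * (k * a)"
  proof -
    have "k * k \<le> k * a" using k by (intro mult_left_mono) auto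
    then show ?thesis using lam(2) unfolding power2_eq_square by linarith
  qed
  then have "lam * (N * d * G) \<le> 5 / 16 * (k * a) * (N * d * G)" using nn by (intro mult_right_mono) auto
  moreover have "s * (N * d * G) \<le> k * a * (N * d * G)" using s nn by (intro mult_right_mono) auto
  ultimately have 1: "s * (N * d * G) + lam * (N * d * G) \<le> a * N * (d * (21 / 16 * (k * G)))"
    by (simp add: algebra_simps)
  have "d * (21 / 16 * (k * G)) \<le> sigma / 5 * d\<^sup>2 + (21 / 16 * (k * G))\<^sup>2 / (4 * (sigma / 5))"
    using nn by (intro AM_GM_scaled) simp
  also have "(21 / 16 * (k * G))\<^sup>2 / (4 * (sigma / 5)) = 2205 / 1024 * (k\<^sup>2 * G\<^sup>2 / sigma)"
    by (simp add: power_mult_distrib power2_eq_square)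
  finally have 2: "a * N * (d * (21 / 16 * (k * G))) \<le> a * N * (sigma / 5 * d\<^sup>2 + 2205 / 1024 * (k\<^sup>2 * G\<^sup>2 / sigma))"
    using nn a by (intro mult_left_mono) auto
  have 3: "lam * (N * (4 * a * G / sigma) * G) \<le> 5 / 16 * k\<^sup>2 * (N * (4 * a * G / sigma) * G)"
    using lam nn a by (intro mult_right_mono) auto
  have "a\<^sup>2 / (s + 1) \<le> a\<^sup>2 / (k * a)"
    using s k a by (intro divide_left_mono) (auto intro!: mult_pos_pos less_le_trans[OF _ s(2)])
  then have "a\<^sup>2 / (s + 1) \<le> a / k" using a by (simp add: power2_eq_square)
  \<comment> \<open>The late restart cancels one factor \<open>k\<close> of \<open>lam\<close>, so
    the noise term is linear in \<open>k * G\<close>, like the diameter term.\<close>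
  then have "lam * (N * (q * (a\<^sup>2 / (s + 1))) * G) \<le> 5 / 16 * k\<^sup>2 * (N * (q * (a / k)) * G)"
    using lam nn q s k a
    by (intro mult_mono mult_left_mono mult_right_mono mult_nonneg_nonneg divide_nonneg_nonneg)
       (auto intro: order_trans[OF _ s(2)])
  also have "\<dots> = a * N * (5 / 16 * (q * (k * G)))" using k by (simp add: power2_eq_square)
  finally have 4: "lam * (N * (q * (a\<^sup>2 / (s + 1))) * G) \<le> \<dots>" .
  have "q * (k * G) \<le> sigma * q\<^sup>2 + (k * G)\<^sup>2 / (4 * sigma)" using nn by (intro AM_GM_scaled)
  also have "\<dots> = 2 * Lnu + 1 / 4 * (k\<^sup>2 * G\<^sup>2 / sigma)" using nn by (simp add: q power_mult_distrib)
  finally have 5: "a * N * (5 / 16 * (q * (k * G))) \<le> a * N * (5 / 16 * (2 * Lnu + 1 / 4 * (k\<^sup>2 * G\<^sup>2 / sigma)))"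
    using nn a by (intro mult_left_mono) auto
  have E: "k\<^sup>2 * G\<^sup>2 / sigma \<ge> 0" using nn by simp
  have "0 \<le> sigma * q\<^sup>2" using nn by simp
  then have Lnu: "Lnu \<ge> 0" using nn by (simp add: q)
  have "G * (s * (N * d) + lam * (N * d + N * (4 * a * G / sigma + q * (a\<^sup>2 / (s + 1)))))
     = (s * (N * d * G) + lam * (N * d * G)) + lam * (N * (4 * a * G / sigma) * G)
       + lam * (N * (q * (a\<^sup>2 / (s + 1))) * G)" by (simp only: distrib_left mult_ac)
  also have "\<dots> \<le> a * N * (sigma / 5 * d\<^sup>2 + 2205 / 1024 * (k\<^sup>2 * G\<^sup>2 / sigma))
     + 5 / 16 * k\<^sup>2 * (N * (4 * a * G / sigma) * G) + a * N * (5 / 16 * (2 * Lnu + 1 / 4 * (k\<^sup>2 * G\<^sup>2 / sigma)))"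
    using 1 2 3 4 5 by linarith
  also have "\<dots> = a * N * (sigma / 5 * d\<^sup>2 + (2205 / 1024 + 5 / 4 + 5 / 64) * (k\<^sup>2 * G\<^sup>2 / sigma) + 5 / 8 * Lnu)"
    by (simp add: algebra_simps power2_eq_square)
  also have "\<dots> \<le> a * N * (sigma / 5 * d\<^sup>2 + 7 / 2 * (k\<^sup>2 * G\<^sup>2 / sigma) + 6 / 5 * Lnu)"
    using nn a E Lnu by (intro mult_left_mono add_mono mult_right_mono) auto
  finally show ?thesis by (simp add: mult.assoc)
qed

context dscmd
begin

lemma theta: "0 < theta" "theta < 1" and B_ge_1: "B \<ge> 1"
  using net by (auto simp: network_assumption_def)

text \<open>A single agent never disagrees; for \<open>T \<le> R\<close> the diameter bound lasts to
  the end; otherwise the consensus bound takes over at \<open>s\<close>, which lies before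
  \<open>T\<close> because \<open>k < a\<close>.\<close>

lemma expected_spread_budget:
  assumes T: "T \<ge> 1"
  defines "N \<equiv> real CARD('v)"
  shows "\<exists>K. mean_le M (\<lambda>w. \<Sum>t=1..T. \<Sum>i\<in>UNIV. norm (x t l w - x t i w)) K \<and>
     (Gf + H) * K \<le> sqrt (real T) * (N * (sigma * d\<^sup>2 / 5
        + 7 / 2 * (4 * N ^ 4 * real B / theta * (Gf + H)\<^sup>2 / sigma) + 6 / 5 * (L * nu)))"
proof -
  have N: "N \<ge> 1" by (simp add: N_def Suc_leI)
  define R where "R = 4 * N ^ 4 * real B / theta"
  define k where "k = sqrt R"
  define a where "a = sqrt (real T)"
  define GH where "GH = Gf + H"
  have G: "GH \<ge> 0" using Gf_nonneg H_nonneg by (simp add: GH_def)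
  have R: "R > 0" using theta N B_ge_1 by (simp add: R_def)
  have k: "k > 0" "k\<^sup>2 = R" using R by (auto simp: k_def)
  have a: "a > 0" "a\<^sup>2 = real T" using T by (auto simp: a_def)
  have E: "R * GH\<^sup>2 / sigma \<ge> 0" using R sigma by simp
  have Ln: "L * nu \<ge> 0" using L_nonneg nu_nonneg by simp
  have sd: "sigma * d\<^sup>2 / 5 \<ge> 0" using sigma by simp
  have goal: "GH * K \<le> a * (N * (sigma * d\<^sup>2 / 5 + 7 / 2 * (R * GH\<^sup>2 / sigma) + 6 / 5 * (L * nu))) \<Longrightarrow> 
     (Gf + H) * K \<le> sqrt (real T) * (N * (sigma * d\<^sup>2 / 5
        + 7 / 2 * (4 * N ^ 4 * real B / theta * (Gf + H)\<^sup>2 / sigma) + 6 / 5 * (L * nu)))" for K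
    by (simp add: GH_def a_def R_def)
  consider "CARD('v) = 1" | "a \<le> k" | "CARD('v) \<ge> 2" "k < a"
    by (metis Suc_1 Suc_leI le_neq_implies_less linorder_not_less finite_UNIV_card_ge_0 finite One_nat_def)
  then show ?thesis
  proof cases
    case 1
    then obtain v where v: "(UNIV :: 'v set) = {v}" using card_1_singletonE by blast
    have "(\<lambda>w. \<Sum>t=1..T. \<Sum>i\<in>UNIV. norm (x t l w - x t i w)) = (\<lambda>w. 0)"
    proof -
      have "i = l" for i using v by (metis UNIV_I singletonD)
      then have "norm (x t l w - x t i w) = 0" for t i w by (metis diff_self norm_zero)
      then show ?thesis unfolding fun_eq_iff by (intro allI sum.neutral ballI)
    qed
    then have "mean_le M (\<lambda>w. \<Sum>t=1..T. \<Sum>i\<in>UNIV. norm (x t l w - x t i w)) 0"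
      by (simp add: mean_le_const)
    moreover have "GH * 0 \<le> a * (N * (sigma * d\<^sup>2 / 5 + 7 / 2 * (R * GH\<^sup>2 / sigma) + 6 / 5 * (L * nu)))"
      using a N E Ln sd by (auto intro!: mult_nonneg_nonneg add_nonneg_nonneg)
    ultimately show ?thesis using goal by blast
  next
    case 2
    have "mean_le M (\<lambda>w. \<Sum>t=1..T. \<Sum>i\<in>UNIV. norm (x t l w - x t i w)) (real T * (N * d))"
      using expected_spread_trivial[of "{1..T}" l] by (simp add: N_def)
    moreover have "GH * (real T * (N * d)) \<le> a * (N * (sigma * d\<^sup>2 / 5 + 5 / 4 * (R * GH\<^sup>2 / sigma)))"
      using trivial_phase_budget[of N a GH d sigma k] N a G d_nonneg sigma 2 k(2) by simp
    moreover have "\<dots> \<le> a * (N * (sigma * d\<^sup>2 / 5 + 7 / 2 * (R * GH\<^sup>2 / sigma) + 6 / 5 * (L * nu)))"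
      using a N E Ln by (intro mult_left_mono) auto
    ultimately show ?thesis using goal order_trans by blast
  next
    case 3
    define s where "s = nat \<lfloor>k * a\<rfloor>"
    have ka: "k * a > 0" using k a by simp
    have s: "real s \<le> k * a" "k * a \<le> real s + 1" using ka unfolding s_def by linarith+
    have "k * a < a * a" using 3 a by simp
    then have "real s < real T" using s a(2) unfolding power2_eq_square by linarith
    then have sT: "s < T" by simp
    \<comment> \<open>The consensus constant equals \<open>2 * N * B + R / 4\<close>. With
      \<open>N \<ge> 2\<close> and \<open>theta < 1\<close> the first part is at most
      \<open>R / 16\<close>, hence \<open>5 / 16\<close>.\<close>
    define lam where "lam = 2 * N * (real B * (1 + N ^ 3 / (2 * theta)))"
    have lam: "0 \<le> lam" "lam \<le> 5 / 16 * k\<^sup>2"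
    proof -
      show "0 \<le> lam" using theta N by (simp add: lam_def)
      have "(2::real) ^ 3 \<le> N ^ 3" using 3 by (intro power_mono) (auto simp: N_def)
      then have "8 * theta \<le> N ^ 3" using theta by simp
      then have "2 * N * real B * (8 * theta) \<le> 2 * N * real B * N ^ 3" using N by (intro mult_left_mono) auto
      then have "2 * N * real B \<le> 2 * N * real B * N ^ 3 / (8 * theta)"
        using theta by (simp add: pos_le_divide_eq mult_ac)
      also have "\<dots> = R / 16" by (simp add: R_def power_numeral_reduce)
      finally have "2 * N * real B \<le> R / 16" .
      moreover have "lam = 2 * N * real B + R / 4"
        unfolding lam_def R_def by (simp add: distrib_left power_numeral_reduce)
      ultimately show "lam \<le> 5 / 16 * k\<^sup>2" unfolding k by simp
    qed
    define q where "q = sqrt (2 * L / sigma) * sqrt nu"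
    have q: "q \<ge> 0" "q\<^sup>2 = 2 * (L * nu) / sigma"
      using L_nonneg nu_nonneg sigma by (auto simp: q_def power_mult_distrib)
    have m1: "mean_le M (\<lambda>w. \<Sum>t=1..s. \<Sum>i\<in>UNIV. norm (x t l w - x t i w)) (real s * (N * d))"
      using expected_spread_trivial[of "{1..s}" l] by (simp add: N_def)
    have m2: "mean_le M (\<lambda>w. \<Sum>t=Suc s..T. \<Sum>i\<in>UNIV. norm (x t l w - x t i w))
      (lam * (N * d + (\<Sum>t=s..<T. N * (2 * al t * (Gf + H) / sigma + sqrt (2 * L / sigma) * (r t * sqrt nu)))))"
      using expected_spread_restart[OF 3(1) sT, of l] by (simp add: N_def lam_def)
    have split: "(\<Sum>t=1..s. h t) + (\<Sum>t=Suc s..T. h t) = (\<Sum>t=1..T. h t)" for h :: "nat \<Rightarrow> real"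
      using sum.ub_add_nat[of 1 s h "T - s"] sT by simp
    have "(\<Sum>t=s..<T. N * (2 * al t * (Gf + H) / sigma + sqrt (2 * L / sigma) * (r t * sqrt nu)))
      = N * (2 * GH / sigma * (\<Sum>t=s..<T. 1 / sqrt (real t + 1)) + q * (\<Sum>t=s..<T. 1 / (real t + 1)))"
    proof -
      have "N * (2 * al t * (Gf + H) / sigma + sqrt (2 * L / sigma) * (r t * sqrt nu))
        = N * (2 * GH / sigma * (1 / sqrt (real t + 1)) + q * (1 / (real t + 1)))" for t
        by (simp add: al r GH_def[symmetric] q_def mult_ac)
      then show ?thesis by (simp only: sum_distrib_left[symmetric] sum.distrib)
    qed
    also have "\<dots> \<le> N * (2 * GH / sigma * (2 * a) + q * (a\<^sup>2 / (real s + 1)))"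
      unfolding a(2) unfolding a_def
      using N G q sigma by (intro mult_left_mono add_mono sum_inverse_tail_le sum_inverse_sqrt_tail_le) auto
    finally have le: "(\<Sum>t=s..<T. N * (2 * al t * (Gf + H) / sigma + sqrt (2 * L / sigma) * (r t * sqrt nu)))
      \<le> N * (4 * a * GH / sigma + q * (a\<^sup>2 / (real s + 1)))" by (simp add: mult_ac)
    let ?K = "real s * (N * d) + lam * (N * d + (\<Sum>t=s..<T. N * (2 * al t * (Gf + H) / sigma + sqrt (2 * L / sigma) * (r t * sqrt nu))))"
    have "mean_le M (\<lambda>w. \<Sum>t=1..T. \<Sum>i\<in>UNIV. norm (x t l w - x t i w)) ?K"
      using mean_le_add[OF m1 m2] by (simp only: split)
    moreover have "GH * ?K \<le> GH * (real s * (N * d) + lam * (N * d + N * (4 * a * GH / sigma + q * (a\<^sup>2 / (real s + 1)))))"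
      using le lam G by (intro mult_left_mono add_left_mono) auto
    moreover have "\<dots> \<le> a * (N * (sigma * d\<^sup>2 / 5 + 7 / 2 * (R * GH\<^sup>2 / sigma) + 6 / 5 * (L * nu)))"
      using restart_phase_budget[of N GH d sigma k a "real s" lam q "L * nu"] N G d_nonneg sigma k 3 s lam q by simp
    ultimately show ?thesis using goal order_trans by blast
  qed
qed

end

text \<open>The terms on the left are, in order, the step-size error (charged to C3), quadratic
  noise (C6), linear noise (C5), the telescoped divergence (C2), and the disagreement, which takes
  what remains of C2, C3 and C6.\<close>

lemma rate_constant_budget:
  fixes N G Gf H R rho D d L nu sigma a C1 C2 C3 C4 C5 C6 C GK A :: real
  assumes nn: "N \<ge> 1" "Gf \<ge> 0" "H \<ge> 0" "d \<ge> 0" "L \<ge> 0" "nu \<ge> 0" "sigma > 0" "rho \<ge> 0"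
    and a: "sqrt 3 \<le> a" and R: "R \<le> N\<^sup>2 * rho" and D: "D\<^sup>2 = sigma * d\<^sup>2 / 2"
    and A: "A = (4 * N + 2 * N\<^sup>2 * rho) * ((N + 1) * Gf + N * H)"
    and C: "C1 \<ge> 0" "C2 = N * D\<^sup>2" "C3 = (A + N * H) * ((Gf + H) / sigma) + N * Gf\<^sup>2 / (2 * sigma)"
      "C4 \<ge> 0" "C5 = d * L * N * sqrt nu" "C6 = N * L * nu"
      "C = Max {C1 + 3 * C6, 4 * C4, sqrt 2 * C2 + 2 * sqrt 2 * C3 + 2 * sqrt 2 * C5}"
    and GK: "GK \<le> a * (N * (sigma * d\<^sup>2 / 5 + 7 / 2 * (R * (Gf + H)\<^sup>2 / sigma) + 6 / 5 * (L * nu)))"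
  shows "2 * a * (N * (2 * Gf\<^sup>2) / sigma) + 3 * (N * L * nu) + 2 * a * (N * L * d * sqrt nu)
     + a * (N * D\<^sup>2) + GK \<le> 3 * C * a"
proof -
  define E where "E = (Gf + H)\<^sup>2 / sigma"
  have E: "E \<ge> 0" using nn by (simp add: E_def)
  have s2: "7 / 5 \<le> sqrt 2" by (rule real_le_rsqrt) (simp add: power2_eq_square)
  have s3: "17 / 10 \<le> sqrt 3" by (rule real_le_rsqrt) (simp add: power2_eq_square)
  have a0: "a \<ge> 17 / 10" using s3 a by linarith
  have C2: "C2 \<ge> 0" and C5: "C5 \<ge> 0" and C6: "C6 \<ge> 0" using nn C by auto
  \<comment> \<open>Since \<open>(N + 1) * Gf + N * H \<ge> N * (Gf + H)\<close> and
    \<open>R \<le> N\<^sup>2 * rho\<close>, the leading product in C3 dominates both the step-size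
    error and the \<open>R\<close> part of the disagreement.\<close>
  have C3: "4 * (N * E) + 2 * N * (R * E) \<le> C3"
  proof -
    have NN: "N * 1 \<le> N * N" using nn by (intro mult_left_mono) auto
    have "N * (Gf + H) \<le> (N + 1) * Gf + N * H" using nn by (simp add: algebra_simps)
    then have "(4 * N + 2 * N\<^sup>2 * rho) * (N * (Gf + H)) \<le> A"
      unfolding A using nn by (intro mult_left_mono) auto
    then have "(4 * N + 2 * N\<^sup>2 * rho) * (N * (Gf + H)) * ((Gf + H) / sigma) \<le> A * ((Gf + H) / sigma)"
      using nn by (intro mult_right_mono) auto
    also have "\<dots> \<le> C3"
    proof -
      have "0 \<le> N * H * ((Gf + H) / sigma)" "0 \<le> N * Gf\<^sup>2 / (2 * sigma)" using nn by auto
      then show ?thesis unfolding C distrib_right[of A] by linarith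
    qed
    also have "(4 * N + 2 * N\<^sup>2 * rho) * (N * (Gf + H)) * ((Gf + H) / sigma) = 4 * (N * N * E) + 2 * N * (N\<^sup>2 * rho * E)"
      by (simp add: E_def power2_eq_square add_divide_distrib algebra_simps)
    finally have "4 * (N * N * E) + 2 * N * (N\<^sup>2 * rho * E) \<le> C3" .
    moreover have "N * E \<le> N * N * E" using NN E mult_right_mono[of N "N * N" E] by simp
    moreover have "2 * N * (R * E) \<le> 2 * N * (N\<^sup>2 * rho * E)"
      using R E nn by (intro mult_left_mono mult_right_mono) auto
    ultimately show ?thesis by linarith
  qed
  have Gf2: "N * (Gf\<^sup>2 / sigma) \<le> N * E" unfolding E_def
    using nn by (intro mult_left_mono divide_right_mono power_mono) auto
  have NE: "N * E \<ge> 0" using nn E by simp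
  have C30: "C3 \<ge> 0"
  proof -
    have "A \<ge> 0" unfolding A using nn by simp
    then show ?thesis unfolding C using nn by simp
  qed
  \<comment> \<open>One copy of \<open>C\<close> is spent on each member of the maximum.\<close>
  have "C \<ge> C1 + 3 * C6" "C \<ge> 4 * C4" "C \<ge> sqrt 2 * C2 + 2 * sqrt 2 * C3 + 2 * sqrt 2 * C5"
    unfolding C(7) by (auto intro: Max_ge)
  moreover have "7 / 5 * (C2 + 2 * C3 + 2 * C5) \<le> sqrt 2 * (C2 + 2 * C3 + 2 * C5)"
    using s2 C2 C30 C5 by (intro mult_right_mono) auto
  moreover have "sqrt 2 * (C2 + 2 * C3 + 2 * C5) = sqrt 2 * C2 + 2 * sqrt 2 * C3 + 2 * sqrt 2 * C5"
    by (simp add: algebra_simps)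
  ultimately have "3 * C \<ge> 3 * C6 + 7 / 5 * (C2 + 2 * C3 + 2 * C5)"
    using C(1,4) by linarith
  then have 1: "(3 * C6 + 7 / 5 * (C2 + 2 * C3 + 2 * C5)) * a \<le> 3 * C * a"
    using a0 by (intro mult_right_mono) auto
  have "4 * (N * (Gf\<^sup>2 / sigma)) + C2 + 2 * C5 + N * (sigma * d\<^sup>2 / 5) + 7 / 2 * (N * (R * E)) + 6 / 5 * C6
    \<le> 9 / 5 * C6 - 3 / 5 * C6 + 7 / 5 * (C2 + 2 * C3 + 2 * C5)"
  proof -
    have "N * (sigma * d\<^sup>2 / 5) = 2 / 5 * C2" by (simp add: C D)
    then show ?thesis using C3 Gf2 NE C5 C6 C30 by (simp add: algebra_simps) 
  qed
  then have "(4 * (N * (Gf\<^sup>2 / sigma)) + C2 + 2 * C5 + N * (sigma * d\<^sup>2 / 5) + 7 / 2 * (N * (R * E)) + 6 / 5 * C6) * a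
    \<le> (6 / 5 * C6 + 7 / 5 * (C2 + 2 * C3 + 2 * C5)) * a"
    using a0 by (intro mult_right_mono) auto
  \<comment> \<open>The quadratic noise stays bounded while the budget \<open>3 * C6 * a\<close>
    grows. As \<open>a \<ge> 5 / 3\<close>, the share \<open>9 / 5\<close> covers it and
    \<open>6 / 5\<close> remains for the disagreement.\<close>
  moreover have "3 * C6 \<le> 9 / 5 * C6 * a"
    using a0 C6 mult_left_mono[of "5 / 3" a "9 / 5 * C6"] by simp
  ultimately have "4 * (N * (Gf\<^sup>2 / sigma)) * a + C2 * a + 2 * C5 * a + N * (sigma * d\<^sup>2 / 5) * a + 7 / 2 * (N * (R * E)) * a
     + 6 / 5 * C6 * a + 3 * C6 \<le> 3 * C * a" using 1 unfolding distrib_right by linarith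
  moreover have "GK \<le> N * (sigma * d\<^sup>2 / 5) * a + 7 / 2 * (N * (R * E)) * a + 6 / 5 * C6 * a"
    using GK by (simp add: E_def C algebra_simps)
  ultimately show ?thesis by (simp add: C mult_ac)
qed

theorem corollary2:
  fixes M :: "'w measure"
    and Fil :: "int \<Rightarrow> 'w measure"
    and X :: "(real^'n::finite) set"
    and f chi :: "'v::finite \<Rightarrow> real^'n \<Rightarrow> real"
    and F :: "real^'n \<Rightarrow> real"
    and g :: "'v \<Rightarrow> real^'n \<Rightarrow> real^'n"
    and Phi :: "real^'n \<Rightarrow> real"
    and dPhi :: "real^'n \<Rightarrow> real^'n"
    and P :: "nat \<Rightarrow> real^'v^'v"
    and alpha r :: "nat \<Rightarrow> real"
    and xi :: "nat \<Rightarrow> 'v \<Rightarrow> 'v \<Rightarrow> 'w \<Rightarrow> real^'n"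
    and G :: "nat \<Rightarrow> 'v \<Rightarrow> real^'n \<Rightarrow> 'w \<Rightarrow> real^'n"
    and x y :: "nat \<Rightarrow> 'v \<Rightarrow> 'w \<Rightarrow> real^'n"
    and x0 :: "'v \<Rightarrow> real^'n"
    and xstar :: "real^'n"
    and B T :: nat
    and l :: 'v
    and N theta sigmaPhi L nu Gf Gchi D omega gamma C1 C2 C3 C4 C5 C6 C :: real
  assumes "prob_space M"
    and "X \<noteq> {}" "convex X" "compact X"
    and "\<And>i. convex_on UNIV (f i)" "\<And>i. convex_on UNIV (chi i)"
    and "F = (\<lambda>z. \<Sum>i\<in>UNIV. f i z + chi i z)"
    and "is_arg_min F (\<lambda>z. z \<in> X) xstar"
    and "mirror_map Phi dPhi sigmaPhi"
    and "L-lipschitz_on UNIV dPhi"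
    and "\<And>a (b :: 'v \<Rightarrow> real^'n) (c :: 'v \<Rightarrow> real).
           (\<forall>i. 0 \<le> c i \<and> c i \<le> 1) \<Longrightarrow> (\<Sum>i\<in>UNIV. c i) = 1 \<Longrightarrow>
           bregman Phi dPhi a (\<Sum>i\<in>UNIV. c i *\<^sub>R b i) \<le> (\<Sum>i\<in>UNIV. c i * bregman Phi dPhi a (b i))"
    and "dscmd_n M X chi Phi dPhi P alpha r xi G x0 x y"
    and "history M Fil X xi G x y"
    and "network_assumption P B theta"
    and "subgradient_assumption M Fil X f g Gf xi G y"
    and "noise_assumption M Fil xi nu"
    and "\<And>t. alpha t = 1 / sqrt (real t + 1)"
    and "\<And>t. r t = 1 / (real t + 1)"
    and "N = real CARD('v)"
    and "Gchi = max_subgradient_norm X chi"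
    and "D = bregman_diameter Phi dPhi X"
    and "omega = (1 - theta / (4 * N\<^sup>2)) powi (- 2)"
    and "gamma = (1 - theta / (4 * N\<^sup>2)) powr (1 / real B)"
    and "C1 = 2 * N * omega / (1 - gamma) * ((N + 1) * Gf + N * Gchi) * (\<Sum>j\<in>UNIV. norm (x0 j))"
    and "C2 = N * D\<^sup>2"
    and "C3 = ((4 * N + 2 * N\<^sup>2 * omega / (1 - gamma)) * ((N + 1) * Gf + N * Gchi) + N * Gchi)
                * ((Gf + Gchi) / sigmaPhi) + N * Gf\<^sup>2 / (2 * sigmaPhi)"
    and "C4 = (4 * N + 2 * N\<^sup>2 * omega / (1 - gamma)) * ((N + 1) * Gf + N * Gchi) * N * sqrt nu
                + (Gf + Gchi) * N\<^sup>2 * sqrt nu"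
    and "C5 = sqrt (2 / sigmaPhi) * D * L * N * sqrt nu"
    and "C6 = N * L * nu"
    and "C = Max {C1 + 3 * C6, 4 * C4, sqrt 2 * C2 + 2 * sqrt 2 * C3 + 2 * sqrt 2 * C5}"
    and "T \<ge> 3"
  shows "prob_space.expectation M (\<lambda>w. F ((1 / real T) *\<^sub>R (\<Sum>t = 1..T. x t l w))) - F xstar
           \<le> 3 * C / sqrt (real T)"
proof -
  define d where "d = sqrt (2 / sigmaPhi) * D"
  interpret prob_space M by (rule assms(1))
  interpret dscmd M X Phi dPhi sigmaPhi L D d Fil f chi g P B theta alpha r xi G x0 x y Gf nu
    by unfold_locales (fact assms d_def)+
  define rho where "rho = omega / (1 - gamma)"
  define R where "R = 4 * N ^ 4 * real B / theta"
  define a where "a = sqrt (real T)"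
  have N: "N \<ge> 1" by (simp add: assms Suc_leI)
  have xs: "xstar \<in> X" using assms(8) by (simp add: is_arg_min_def)
  have T: "T \<ge> 1" and a: "a > 0" "sqrt 3 \<le> a" using assms(31) by (auto simp: a_def)
  have rho: "0 < rho" "4 * N\<^sup>2 * real B / theta \<le> rho"
    unfolding rho_def using geometric_constant_ge[OF theta N B_ge_1 refl assms(22,23)] by auto
  have R: "R \<le> N\<^sup>2 * rho"
    using mult_left_mono[OF rho(2), of "N\<^sup>2"] by (simp add: R_def power_numeral_reduce mult_ac)
  obtain K where K: "mean_le M (\<lambda>w. \<Sum>t=1..T. \<Sum>i\<in>UNIV. norm (x t l w - x t i w)) K"
    "(Gf + Gchi) * K \<le> a * (N * (sigmaPhi * d\<^sup>2 / 5
        + 7 / 2 * (R * (Gf + Gchi)\<^sup>2 / sigmaPhi) + 6 / 5 * (L * nu)))"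
    using expected_spread_budget[OF T, of l] by (auto simp: a_def R_def assms(19,20))
  define gap where "gap = expectation (\<lambda>w. F ((1 / real T) *\<^sub>R (\<Sum>t = 1..T. x t l w))) - F xstar"
  have "real T * gap \<le> (\<Sum>t<T. N * (alpha t * (2 * Gf\<^sup>2) / sigmaPhi) + 1 / alpha t * noise_mean t)
      + a * (N * D\<^sup>2) + (Gf + Gchi) * K"
    using expected_regret[OF xs T K(1)] by (simp add: gap_def a_def assms(7,19,20))
  also have "(\<Sum>t<T. N * (alpha t * (2 * Gf\<^sup>2) / sigmaPhi) + 1 / alpha t * noise_mean t)
    = (\<Sum>t<T. 1 / sqrt (real t + 1)) * (N * (2 * Gf\<^sup>2) / sigmaPhi)
      + (\<Sum>t<T. sqrt (real t + 1) / (real t + 1)\<^sup>2) * (N * L * nu)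
      + (\<Sum>t<T. 1 / sqrt (real t + 1)) * (N * L * d * sqrt nu)"
  proof -
    have "N * (alpha t * (2 * Gf\<^sup>2) / sigmaPhi) + 1 / alpha t * noise_mean t
      = 1 / sqrt (real t + 1) * (N * (2 * Gf\<^sup>2) / sigmaPhi)
      + sqrt (real t + 1) / (real t + 1)\<^sup>2 * (N * L * nu) + 1 / sqrt (real t + 1) * (N * L * d * sqrt nu)" for t
    proof -
      \<comment> \<open>The quotient \<open>r t / alpha t\<close> equals \<open>alpha t\<close>:
        linear noise sums to order \<open>sqrt T\<close>, and quadratic noise is summable.\<close>
      have "sqrt (real t + 1) * r t = 1 / sqrt (real t + 1)"
        using sqrt_divide_self_eq[of "real t + 1"] by (simp add: assms(18) divide_inverse)
      moreover have "1 / alpha t * noise_mean t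
          = sqrt (real t + 1) * (r t)\<^sup>2 * (N * L * nu) + sqrt (real t + 1) * r t * (N * L * d * sqrt nu)"
        unfolding noise_mean_def assms(17,19) by (simp add: distrib_left mult_ac)
      ultimately show ?thesis by (simp add: assms(17) assms(18)[of t] power_divide mult_ac)
    qed
    then show ?thesis by (simp only: sum.distrib sum_distrib_right)
  qed
  also have "\<dots> \<le> 2 * a * (N * (2 * Gf\<^sup>2) / sigmaPhi) + 3 * (N * L * nu) + 2 * a * (N * L * d * sqrt nu)"
    unfolding a_def using N L_nonneg nu_nonneg d_nonneg sigma T
    by (intro add_mono mult_right_mono sum_inverse_sqrt_le sum_three_halves_le) auto
  finally have "real T * gap \<le> 2 * a * (N * (2 * Gf\<^sup>2) / sigmaPhi) + 3 * (N * L * nu)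
      + 2 * a * (N * L * d * sqrt nu) + a * (N * D\<^sup>2) + (Gf + Gchi) * K" by simp
  also have "\<dots> \<le> 3 * C * a"
  proof (rule rate_constant_budget[OF N Gf_nonneg _ d_nonneg L_nonneg nu_nonneg sigma _ a(2) R D_sq refl])
    show "0 \<le> Gchi" using H_nonneg assms(20) by simp
    show "0 \<le> rho" using rho by simp
    have W: "0 \<le> (N + 1) * Gf + N * Gchi" and Gchi: "0 \<le> Gchi"
      using N Gf_nonneg H_nonneg assms(20) by auto
    have "C1 = 2 * N * rho * ((N + 1) * Gf + N * Gchi) * (\<Sum>j\<in>UNIV. norm (x0 j))"
      by (simp add: assms(24) rho_def)
    also have "\<dots> \<ge> 0" using W rho N by (intro mult_nonneg_nonneg sum_nonneg) auto
    finally show "0 \<le> C1" .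
    have "C4 = (4 * N + 2 * N\<^sup>2 * rho) * ((N + 1) * Gf + N * Gchi) * N * sqrt nu
        + (Gf + Gchi) * N\<^sup>2 * sqrt nu"
      by (simp add: assms(27) rho_def)
    also have "\<dots> \<ge> 0" using W rho N nu_nonneg Gf_nonneg Gchi
      by (intro add_nonneg_nonneg mult_nonneg_nonneg) auto
    finally show "0 \<le> C4" .
    show "C3 = ((4 * N + 2 * N\<^sup>2 * rho) * ((N + 1) * Gf + N * Gchi) + N * Gchi)
                * ((Gf + Gchi) / sigmaPhi) + N * Gf\<^sup>2 / (2 * sigmaPhi)"
      by (simp add: assms(26) rho_def)
    show "C5 = d * L * N * sqrt nu" by (simp add: assms(28) d_def)
  qed (fact assms K)+
  finally have "real T * gap \<le> 3 * C * a" .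
  then have "gap \<le> 3 * C * a / real T" using T by (simp add: field_simps)
  also have "real T = a * a" by (simp add: a_def)
  also have "3 * C * a / (a * a) = 3 * C / sqrt (real T)" using a by (simp add: a_def[symmetric])
  finally show ?thesis by (simp add: gap_def)
qed

end
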